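(* Let $G$ be a $\mathfrak{C}_9$-group. Then $G$ is a $p$-group for some prime number $p$ if and only if $G\cong (C_2)^8$ or $G\cong (C_3)^5$ or $G\cong (C_5)^3$.
   Context: $(C_k)^m$ denotes the direct product of $m$ copies of the cyclic group $C_k$ of order $k$. A cover for a group $G$ is a set $\mathcal{C}$ of proper subgroups of $G$ whose set-theoretic union is $G$. It is irredundant if no proper subset of $\mathcal{C}$ is a cover for $G$, maximal if all members of $\mathcal{C}$ are maximal subgroups of $G$, and core-free if $D=\bigcap_{M\in\mathcal{C}}M$ is core-free in $G$, i.e. $\bigcap_{g\in G}g^{-1}Dg=1$. A $\mathfrak{C}_n$-cover for $G$ is an irredundant maximal core-free cover $\mathcal{C}$ for $G$ with $|\mathcal{C}|=n$; a group having a $\mathfrak{C}_n$-cover is called a $\mathfrak{C}_n$-group. *)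

theory Defs
  imports "HOL-Algebra.Algebra" "HOL-Computational_Algebra.Primes"
begin

definition maximal_subgroup :: "'a set \<Rightarrow> ('a, 'b) monoid_scheme \<Rightarrow> bool" where
  "maximal_subgroup M G \<longleftrightarrow>
     subgroup M G \<and> M \<noteq> carrier G \<and>
     (\<forall>H. subgroup H G \<and> M \<subseteq> H \<longrightarrow> H = M \<or> H = carrier G)"

definition normal_core :: "('a, 'b) monoid_scheme \<Rightarrow> 'a set \<Rightarrow> 'a set" where
  "normal_core G D = (\<Inter>g\<in>carrier G. (inv\<^bsub>G\<^esub> g <#\<^bsub>G\<^esub> D) #>\<^bsub>G\<^esub> g)"

definition group_cover :: "('a, 'b) monoid_scheme \<Rightarrow> 'a set set \<Rightarrow> bool" where
  "group_cover G C \<longleftrightarrow> (\<forall>H\<in>C. subgroup H G \<and> H \<noteq> carrier G) \<and> \<Union>C = carrier G"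

definition irredundant_cover :: "('a, 'b) monoid_scheme \<Rightarrow> 'a set set \<Rightarrow> bool" where
  "irredundant_cover G C \<longleftrightarrow> group_cover G C \<and> (\<forall>C'. C' \<subset> C \<longrightarrow> \<not> group_cover G C')"

definition maximal_cover :: "('a, 'b) monoid_scheme \<Rightarrow> 'a set set \<Rightarrow> bool" where
  "maximal_cover G C \<longleftrightarrow> group_cover G C \<and> (\<forall>M\<in>C. maximal_subgroup M G)"

definition core_free_cover :: "('a, 'b) monoid_scheme \<Rightarrow> 'a set set \<Rightarrow> bool" where
  "core_free_cover G C \<longleftrightarrow> group_cover G C \<and> normal_core G (\<Inter>C) = {\<one>\<^bsub>G\<^esub>}"

definition Cn_cover :: "nat \<Rightarrow> ('a, 'b) monoid_scheme \<Rightarrow> 'a set set \<Rightarrow> bool" where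
  "Cn_cover n G C \<longleftrightarrow>
     irredundant_cover G C \<and> maximal_cover G C \<and> core_free_cover G C \<and>
     finite C \<and> card C = n"

definition Cn_group :: "nat \<Rightarrow> ('a, 'b) monoid_scheme \<Rightarrow> bool" where
  "Cn_group n G \<longleftrightarrow> group G \<and> (\<exists>C. Cn_cover n G C)"

text \<open>
  Groups are not assumed finite. Since \<open>group.ord\<close> is 0 on elements of infinite order,
  the condition below rules those out.
\<close>

definition p_group :: "nat \<Rightarrow> ('a, 'b) monoid_scheme \<Rightarrow> bool" where
  "p_group p G \<longleftrightarrow> group G \<and> (\<forall>x\<in>carrier G. \<exists>k::nat. group.ord G x = p ^ k)"

definition cyclic_power :: "nat \<Rightarrow> nat \<Rightarrow> (nat \<Rightarrow> int) monoid" where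
  "cyclic_power k m = product_group {..<m} (\<lambda>_. integer_mod_group k)"

end

(* A maximal subgroup M of a finite p-group is normal of index p, so all commutators and p-th powers
   lie in every member of the cover; core-freeness makes the cover intersect trivially and hence G
   elementary abelian of order p^d, covered by nine hyperplanes. (Finiteness comes from B. H. Neumann's
   argument: by irredundancy G is a finite union of cosets of the intersection.)

   For g in G let z(g) be the number of members containing g. If g is not 1, choose a member M not
   containing g and an element c lying in M only: the p elements c g^t lie in p different members, none
   containing g, so z(g) + p <= 9. Hence p is 2, 3, 5 or 7. The sums over g of the binomial coefficients
   (z(g) choose j) count intersections of members and are known, and comparing them with the bounds on
   z(g) excludes p = 7 and most orders; p = 2 gives 2^8 directly. For p = 5 an element with z = 4 yields an
   injection from the elements outside those four members into the 5! bijections onto the other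
   five. For p = 3 and d <= 4 the case of three collinear members is treated in a coset of
   their intersection. For p = 3 and d >= 6 there is no ternary [5,3,3] code, which forces d = 6 and puts any
   four members in general position; then an element with z = 6 gives a hyperplane that covers G together
   with those six members, and every irredundant subcover contradicts the order bounds. *)
theory Submission
  imports Defs
begin

section \<open>Elementary abelian groups\<close>

text \<open>Choose a functional with kernel M for each member M. The group becomes a linear code of
  length nine over the field with p elements, z(g) counts the zero coordinates of the word of g, and
  the bound on z(g) says that the minimum distance is at least p. Covering means that every word has
  a zero, irredundancy that each coordinate is the only zero of some word. The counting uses a
  polynomial in z of constant sign on the values open to g other than 1; its sum over the group is
  fixed by the moments, and its value at z(1) = 9 spoils the balance. The obstacle is that the
  moment of order j is computed only when any j members are independent. For j = 2 this is
  automatic, as no member contains another; for j = 3 it is the absence of collinear triples; for j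
  = 4 it comes out of the code bound. Hence p = 3 needs geometry besides counting.\<close>

locale elementary_abelian = comm_group +
  fixes p :: nat
  assumes finite_carrier: "finite (carrier G)"
    and prime_p: "Factorial_Ring.prime p"
    and exponent_p: "x \<in> carrier G \<Longrightarrow> x [^] p = \<one>"
begin

lemma p_ge_2: "2 \<le> p"
  using prime_p by (rule prime_ge_2_nat)

lemma subgroup_mult_cancel:
  assumes "subgroup M G" "x \<in> M" "y \<in> carrier G"
  shows "x \<otimes> y \<in> M \<longleftrightarrow> y \<in> M"
proof
  assume "x \<otimes> y \<in> M"
  then have "inv x \<otimes> (x \<otimes> y) \<in> M"
    using assms by (meson subgroup.m_closed subgroup.m_inv_closed)
  then show "y \<in> M"
    using assms by (simp add: subgroup.mem_carrier m_assoc[symmetric])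
qed (use assms in \<open>simp add: subgroup.m_closed\<close>)

lemma subgroup_pow_closed:
  assumes "subgroup M G" "x \<in> M"
  shows "x [^] (k::nat) \<in> M"
  using assms by (induction k) (auto simp: subgroup.m_closed subgroup.one_closed)

lemma pow_mod:
  assumes "x \<in> carrier G"
  shows "x [^] (k mod p) = x [^] (k::nat)"
proof -
  have "x [^] k = x [^] (p * (k div p) + k mod p)" by simp
  also have "\<dots> = (x [^] p) [^] (k div p) \<otimes> x [^] (k mod p)"
    using assms by (simp only: nat_pow_mult[symmetric] nat_pow_pow)
  finally show ?thesis using assms by (simp add: exponent_p)
qed

text \<open>Exponents prime to \<open>p\<close> act invertibly: a Bezout inverse \<open>j\<close> of
  \<open>k\<close> gives \<open>x [^] (k * j) = x\<close>.\<close>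

lemma pow_mem_imp_mem:
  assumes "subgroup M G" "x \<in> carrier G" "x [^] k \<in> M" "\<not> p dvd (k::nat)"
  shows "x \<in> M"
proof -
  have "coprime k p"
    using assms(4) prime_p by (metis coprime_commute prime_imp_coprime)
  moreover have "k \<noteq> 0" using assms(4) by (intro notI) simp
  ultimately obtain j i where ji: "k * j = p * i + 1"
    using bezout_nat[of k p] by (metis coprime_imp_gcd_eq_1)
  have "x [^] (k * j) = (x [^] p) [^] i \<otimes> x"
    using assms(2) by (simp add: ji nat_pow_pow flip: nat_pow_mult)
  then have "x [^] (k * j) = x"
    using assms(2) by (simp add: exponent_p)
  then show ?thesis
    using subgroup_pow_closed[OF assms(1,3), of j] assms(2) by (simp add: nat_pow_pow)
qed

lemma maximal_imp_subgroup: "maximal_subgroup M G \<Longrightarrow> subgroup M G"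
  by (simp add: maximal_subgroup_def)

text \<open>\<open>?H\<close> is the subgroup generated by \<open>M\<close> and \<open>x\<close>, so
  maximality makes it all of \<open>G\<close>. The exponent \<open>t\<close> is the coordinate of
  \<open>y\<close> modulo \<open>M\<close> in units of \<open>inv x\<close>.\<close>

lemma shift_into_maximal:
  assumes M: "maximal_subgroup M G" and x: "x \<in> carrier G" "x \<notin> M" and y: "y \<in> carrier G"
  shows "\<exists>t<p. y \<otimes> x [^] t \<in> M"
proof -
  let ?H = "{z \<in> carrier G. \<exists>t::nat. z \<otimes> x [^] t \<in> M}"
  have sM: "subgroup M G" using M by (rule maximal_imp_subgroup)
  have "subgroup ?H G"
  proof (rule subgroupI)
    have "\<one> \<otimes> x [^] (0::nat) \<in> M" using sM by (simp add: subgroup.one_closed)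
    then show "?H \<noteq> {}" by blast
  next
    fix a assume a: "a \<in> ?H"
    then obtain t :: nat where t: "a \<otimes> x [^] t \<in> M" and ac: "a \<in> carrier G" by blast
    \<comment> \<open>Exponents in \<open>?H\<close> are natural numbers, so \<open>- t\<close> is
      represented by \<open>(p - 1) * t\<close>.\<close>
    have "inv a \<otimes> x [^] ((p - 1) * t) = inv a \<otimes> inv (x [^] t)"
    proof -
      have "(p - 1) * t + t = p * t" using p_ge_2 by (cases p) auto
      then have "x [^] ((p - 1) * t) \<otimes> x [^] t = x [^] (p * t)"
        using x by (simp add: nat_pow_mult)
      also have "\<dots> = \<one>" using x by (simp add: exponent_p flip: nat_pow_pow)
      finally show ?thesis using x inv_equality by (metis nat_pow_closed)
    qed
    also have "\<dots> = inv (a \<otimes> x [^] t)" using x ac by (simp add: inv_mult)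
    also have "\<dots> \<in> M" using t sM by (rule subgroup.m_inv_closed[rotated])
    finally show "inv a \<in> ?H" using ac by blast
  next
    fix a b assume "a \<in> ?H" "b \<in> ?H"
    then obtain s t :: nat where st: "a \<otimes> x [^] s \<in> M" "b \<otimes> x [^] t \<in> M"
      and ab: "a \<in> carrier G" "b \<in> carrier G" by blast
    have "(a \<otimes> b) \<otimes> x [^] (s + t) = (a \<otimes> x [^] s) \<otimes> (b \<otimes> x [^] t)"
      using ab x by (simp add: m_ac flip: nat_pow_mult)
    then have "(a \<otimes> b) \<otimes> x [^] (s + t) \<in> M" using st sM by (simp add: subgroup.m_closed)
    then show "a \<otimes> b \<in> ?H" using ab by blast
  qed auto
  moreover have "M \<subseteq> ?H"
  proof
    fix m assume m: "m \<in> M"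
    then have "m \<otimes> x [^] (0::nat) \<in> M" "m \<in> carrier G"
      using sM by (auto simp: subgroup.mem_carrier)
    then show "m \<in> ?H" by blast
  qed
  moreover have "x \<in> ?H"
  proof -
    have "x \<otimes> x [^] (p - 1) = x [^] p"
      using x p_ge_2 by (metis Suc_diff_1 nat_pow_Suc2 prime_gt_0_nat prime_p)
    then have "x \<otimes> x [^] (p - 1) \<in> M"
      using x sM by (simp add: exponent_p subgroup.one_closed)
    then show ?thesis using x by blast
  qed
  ultimately have "?H = carrier G" using M x(2) unfolding maximal_subgroup_def by blast
  then obtain t :: nat where "y \<otimes> x [^] t \<in> M" using y by blast
  then have "y \<otimes> x [^] (t mod p) \<in> M" using x by (simp add: pow_mod)
  then show ?thesis using p_ge_2 by (intro exI[of _ "t mod p"]) simp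
qed

lemma shift_unique:
  assumes M: "subgroup M G" and x: "x \<in> carrier G" "x \<notin> M" and y: "y \<in> carrier G"
    and st: "y \<otimes> x [^] s \<in> M" "y \<otimes> x [^] t \<in> M" "s < p" "t < (p::nat)"
  shows "s = t"
proof -
  have *: "\<not> u < v" if uv: "y \<otimes> x [^] u \<in> M" "y \<otimes> x [^] v \<in> M" "v < p" for u v :: nat
  proof
    assume "u < v"
    have "(y \<otimes> x [^] u) \<otimes> x [^] (v - u) = y \<otimes> x [^] v"
      using x y \<open>u < v\<close> by (simp add: m_assoc nat_pow_mult)
    then have "x [^] (v - u) \<in> M"
      by (metis M subgroup_mult_cancel nat_pow_closed uv(1,2) x(1))
    moreover have "\<not> p dvd v - u"
      using \<open>u < v\<close> uv(3) by (auto dest: dvd_imp_le)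
    ultimately show False using pow_mem_imp_mem M x by blast
  qed
  show ?thesis using *[OF st(1,2)] *[OF st(2,1)] st(3,4) by simp
qed

text \<open>The second isomorphism theorem in counting form: shifting along some \<open>x\<close> in
  \<open>H - M\<close> is a bijection from \<open>H\<close> to \<open>p\<close> copies of the
  intersection.\<close>

lemma card_Int_maximal:
  assumes H: "subgroup H G" and M: "maximal_subgroup M G" and HM: "\<not> H \<subseteq> M"
  shows "card H = p * card (H \<inter> M)"
proof -
  have sM: "subgroup M G" using M by (rule maximal_imp_subgroup)
  obtain x where x: "x \<in> H" "x \<notin> M" using HM by blast
  have xc: "x \<in> carrier G" using x H by (simp add: subgroup.mem_carrier)
  have Hc: "h \<in> carrier G" if "h \<in> H" for h using that H by (simp add: subgroup.mem_carrier)
  have xp: "x [^] t \<in> H" for t :: nat using H x(1) by (rule subgroup_pow_closed)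
  let ?f = "\<lambda>y. (SOME t. t < p \<and> y \<otimes> x [^] t \<in> M)"
  have f: "?f y < p \<and> y \<otimes> x [^] ?f y \<in> M" if "y \<in> H" for y
    using someI_ex[OF shift_into_maximal[OF M xc x(2) Hc[OF that]]] .
  have "bij_betw (\<lambda>y. (y \<otimes> x [^] ?f y, ?f y)) H ((H \<inter> M) \<times> {..<p})"
  proof (rule bij_betwI')
    fix y z assume yz: "y \<in> H" "z \<in> H"
    show "((y \<otimes> x [^] ?f y, ?f y) = (z \<otimes> x [^] ?f z, ?f z)) = (y = z)"
      using yz xc Hc by auto
  next
    fix y assume "y \<in> H"
    then show "(y \<otimes> x [^] ?f y, ?f y) \<in> (H \<inter> M) \<times> {..<p}"
      using f[of y] xp H by (simp add: subgroup.m_closed)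
  next
    fix w assume "w \<in> (H \<inter> M) \<times> {..<p}"
    then obtain m t where w: "w = (m, t)" "m \<in> H" "m \<in> M" "t < p" by auto
    let ?y = "m \<otimes> inv (x [^] t)"
    have y: "?y \<in> H" using w xp H by (simp add: subgroup.m_closed subgroup.m_inv_closed)
    have e: "?y \<otimes> x [^] t = m" using w xc Hc by (simp add: m_assoc)
    have "?f ?y = t"
      using shift_unique[OF sM xc x(2) Hc[OF y]] f[OF y] e w by metis
    then show "\<exists>y\<in>H. w = (y \<otimes> x [^] ?f y, ?f y)" using y e w by (intro bexI[of _ ?y]) auto
  qed
  then have "card H = card ((H \<inter> M) \<times> {..<p})" by (rule bij_betw_same_card)
  then show ?thesis by (simp add: card_cartesian_product mult.commute)
qed

lemma finite_subgroup: "subgroup H G \<Longrightarrow> finite H"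
  by (meson finite_carrier finite_subset subgroup.subset)

lemma card_subgroup_pos: "subgroup H G \<Longrightarrow> 0 < card H"
  by (auto simp: card_gt_0_iff finite_subgroup dest: subgroup.one_closed)

lemma card_Int_maximal_le:
  assumes H: "subgroup H G" and M: "maximal_subgroup M G"
  shows "card H \<le> p * card (H \<inter> M)"
proof (cases "H \<subseteq> M")
  case True
  then have "H \<inter> M = H" by blast
  then show ?thesis using p_ge_2 by simp
qed (use card_Int_maximal[OF assms] in simp)

lemma card_maximal:
  assumes "maximal_subgroup M G"
  shows "card (carrier G) = p * card M"
proof -
  have "M \<subseteq> carrier G" "M \<noteq> carrier G"
    using assms by (auto simp: maximal_subgroup_def dest: subgroup.subset)
  then have "\<not> carrier G \<subseteq> M" "carrier G \<inter> M = M" by auto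
  then show ?thesis using card_Int_maximal[OF subgroup_self assms] by simp
qed

text \<open>The factor \<open>carrier G\<close> gives the empty family the value
  \<open>carrier G\<close> instead of \<open>UNIV\<close>; that is where arguments adding one member
  at a time begin.\<close>

definition common :: "'a set set \<Rightarrow> 'a set" where
  "common S = carrier G \<inter> \<Inter>S"

lemma subgroup_common:
  assumes "\<And>M. M \<in> S \<Longrightarrow> maximal_subgroup M G"
  shows "subgroup (common S) G"
proof (rule subgroupI)
  have "\<one> \<in> common S"
    using assms unfolding common_def by (auto simp: maximal_imp_subgroup subgroup.one_closed)
  then show "common S \<noteq> {}" by blast
qed (use assms in \<open>auto simp: common_def maximal_imp_subgroup subgroup.m_closed subgroup.m_inv_closed\<close>)

lemma common_insert: "common (insert M S) = common S \<inter> M"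
  by (auto simp: common_def)

lemma common_antimono: "S \<subseteq> T \<Longrightarrow> common T \<subseteq> common S"
  by (auto simp: common_def)

lemma card_common_diff_le:
  assumes "finite T" "S \<subseteq> T" "\<And>M. M \<in> T \<Longrightarrow> maximal_subgroup M G"
  shows "card (common S) \<le> p ^ card (T - S) * card (common T)"
proof -
  have "finite (T - S)" using assms by simp
  have step: "U \<subseteq> T - S \<Longrightarrow> card (common S) \<le> p ^ card U * card (common (S \<union> U))"
    if "finite U" for U
    using that
  proof (induction U rule: finite_induct)
    case (insert M U)
    have "card (common (S \<union> U)) \<le> p * card (common (S \<union> U) \<inter> M)"
      using insert.prems assms by (intro card_Int_maximal_le subgroup_common) auto
    then have "p ^ card U * card (common (S \<union> U)) \<le> p ^ card U * (p * card (common (S \<union> U) \<inter> M))"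
      by simp
    moreover have "card (common S) \<le> p ^ card U * card (common (S \<union> U))"
      using insert by auto
    ultimately have "card (common S) \<le> p ^ card U * (p * card (common (S \<union> U) \<inter> M))"
      by (rule order_trans[rotated])
    moreover have "common (S \<union> insert M U) = common (S \<union> U) \<inter> M"
      by (simp add: common_insert)
    moreover have "p ^ card (insert M U) = p ^ card U * p"
      using insert.hyps by simp
    ultimately show ?case by (simp only: mult.assoc)
  qed simp
  from step[of "T - S"] \<open>finite (T - S)\<close> show ?thesis
    using assms(2) by (simp add: Un_absorb1)
qed

end

section \<open>Irredundant covers by hyperplanes\<close>

lemma card_filter_eq_sum:
  "finite A \<Longrightarrow> card {x \<in> A. P x} = (\<Sum>x\<in>A. if P x then 1 else 0)"
  by (simp only: card_eq_sum sum.inter_filter)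

text \<open>The number of members and their intersection are left open, because the bounds for
  \<open>p = 3\<close> are later applied to a second cover of the same group. Irredundancy takes the
  form of private elements.\<close>

locale hyperplane_cover = elementary_abelian +
  fixes C :: "'a set set"
  assumes finite_cover: "finite C"
    and maximal_member: "M \<in> C \<Longrightarrow> maximal_subgroup M G"
    and covered: "g \<in> carrier G \<Longrightarrow> \<exists>M\<in>C. g \<in> M"
    and private_ex: "M \<in> C \<Longrightarrow> \<exists>c\<in>carrier G. \<forall>N\<in>C - {M}. c \<notin> N"
begin

definition priv :: "'a set \<Rightarrow> 'a" where
  "priv M = (SOME c. c \<in> carrier G \<and> (\<forall>N\<in>C - {M}. c \<notin> N))"

definition zeros :: "'a \<Rightarrow> 'a set set" where
  "zeros g = {M \<in> C. g \<in> M}"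

lemma priv:
  assumes "M \<in> C"
  shows priv_carrier: "priv M \<in> carrier G"
    and priv_mem_iff: "N \<in> C \<Longrightarrow> priv M \<in> N \<longleftrightarrow> N = M"
proof -
  have *: "priv M \<in> carrier G \<and> (\<forall>N\<in>C - {M}. priv M \<notin> N)"
    unfolding priv_def using private_ex[OF assms, unfolded Bex_def] by (rule someI_ex)
  then show "priv M \<in> carrier G" ..
  then obtain K where "K \<in> C" "priv M \<in> K" using covered by blast
  then show "N \<in> C \<Longrightarrow> priv M \<in> N \<longleftrightarrow> N = M" using * by blast
qed

lemma subgroup_member: "M \<in> C \<Longrightarrow> subgroup M G"
  using maximal_member maximal_imp_subgroup by blast

lemma subgroup_common_sub: "S \<subseteq> C \<Longrightarrow> subgroup (common S) G"
  using maximal_member by (intro subgroup_common) blast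

lemma zeros_subset: "zeros g \<subseteq> C"
  by (auto simp: zeros_def)

lemma finite_zeros: "finite (zeros g)"
  using zeros_subset finite_cover by (rule finite_subset)

text \<open>Multiplying by powers of \<open>g\<close> does not change membership in a subgroup
  containing \<open>g\<close>, so all shifts of \<open>y\<close> still avoid \<open>zeros g\<close>.
  A member omitting \<open>g\<close> contains only one of the \<open>p\<close> shifts, so the
  members found are distinct.\<close>

lemma shifts_avoid_zeros:
  assumes g: "g \<in> carrier G" and y: "y \<in> carrier G" and avoid: "\<And>N. N \<in> zeros g \<Longrightarrow> y \<notin> N"
  obtains f where "inj_on f {..<p}" "\<And>t. t < p \<Longrightarrow> f t \<in> C - zeros g"
    "\<And>t. t < p \<Longrightarrow> y \<otimes> g [^] (t::nat) \<in> f t"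
proof -
  have "\<exists>N\<in>C. y \<otimes> g [^] t \<in> N" for t :: nat using g y by (intro covered) simp
  then obtain f where f: "\<And>t::nat. f t \<in> C \<and> y \<otimes> g [^] t \<in> f t" by metis
  have nz: "g \<notin> f t" for t
  proof
    assume "g \<in> f t"
    then have "g [^] t \<in> f t" using f subgroup_member subgroup_pow_closed by blast
    then have "y \<in> f t"
      using f[of t] g y subgroup_member subgroup_mult_cancel[of "f t" "g [^] t" y] by (simp add: m_comm)
    then show False using avoid[of "f t"] f \<open>g \<in> f t\<close> by (auto simp: zeros_def)
  qed
  show thesis
  proof (rule that)
    show "inj_on f {..<p}"
    proof (rule inj_onI)
      fix s t assume "s \<in> {..<p}" "t \<in> {..<p}" "f s = f t"
      then show "s = t"
        using shift_unique[of "f s" g y s t] f[of s] f[of t] nz[of s] g y subgroup_member by simp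
    qed
  qed (use f nz in \<open>auto simp: zeros_def\<close>)
qed

lemma zeros_bound:
  assumes g: "g \<in> carrier G" and M: "M \<in> C" "g \<notin> M"
  shows "card (zeros g) + p \<le> card C"
proof -
  have "priv M \<notin> N" if "N \<in> zeros g" for N
    using that M priv_mem_iff by (auto simp: zeros_def)
  then obtain f where f: "inj_on f {..<p}" "\<And>t. t < p \<Longrightarrow> f t \<in> C - zeros g"
    using shifts_avoid_zeros[OF g priv_carrier[OF M(1)]] by metis
  have "p = card (f ` {..<p})" using f(1) by (simp add: card_image)
  also have "\<dots> \<le> card (C - zeros g)"
    using f(2) finite_cover by (intro card_mono) auto
  also have "\<dots> = card C - card (zeros g)"
    by (simp add: card_Diff_subset finite_zeros zeros_subset)
  finally show ?thesis using p_ge_2 by simp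
qed

lemma p_le_card:
  assumes "C \<noteq> {}"
  shows "p \<le> card C"
proof -
  obtain M where M: "M \<in> C" using assms by blast
  then have "M \<subseteq> carrier G" "M \<noteq> carrier G"
    using maximal_member[OF M] by (auto simp: maximal_subgroup_def subgroup.subset)
  then obtain g where "g \<in> carrier G" "g \<notin> M" by blast
  then show ?thesis using zeros_bound[of g M] M by simp
qed

lemma zeros_pos: "g \<in> carrier G \<Longrightarrow> 1 \<le> card (zeros g)"
  using covered finite_zeros by (auto simp: Suc_le_eq card_gt_0_iff zeros_def)

lemma zeros_one: "zeros \<one> = C"
  by (auto simp: zeros_def subgroup_member subgroup.one_closed)

lemma zeros_eq_imp_common: "g \<in> carrier G \<Longrightarrow> zeros g = C \<Longrightarrow> g \<in> common C"
  by (auto simp: zeros_def common_def)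

lemma mem_common_iff: "S \<subseteq> C \<Longrightarrow> g \<in> common S \<longleftrightarrow> g \<in> carrier G \<and> S \<subseteq> zeros g"
  by (auto simp: common_def zeros_def)

text \<open>Double counting of the pairs of an element \<open>g\<close> and a set of
  \<open>j\<close> members containing it.\<close>

lemma sum_choose_zeros:
  "(\<Sum>g\<in>carrier G. card (zeros g) choose j) = (\<Sum>S | S \<subseteq> C \<and> card S = j. card (common S))"
proof -
  let ?P = "{S. S \<subseteq> C \<and> card S = j}"
  have fP: "finite ?P" using finite_cover by simp
  have "card (zeros g) choose j = (\<Sum>S\<in>?P. if g \<in> common S then 1 else 0)" if "g \<in> carrier G" for g
  proof -
    have "card (zeros g) choose j = card {S. S \<subseteq> zeros g \<and> card S = j}"
      by (simp add: n_subsets finite_zeros)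
    also have "{S. S \<subseteq> zeros g \<and> card S = j} = {S \<in> ?P. g \<in> common S}"
      using zeros_subset[of g] that mem_common_iff by blast
    also have "card \<dots> = (\<Sum>S\<in>?P. if g \<in> common S then 1 else 0)"
      using fP by (rule card_filter_eq_sum)
    finally show ?thesis .
  qed
  then have "(\<Sum>g\<in>carrier G. card (zeros g) choose j)
      = (\<Sum>g\<in>carrier G. \<Sum>S\<in>?P. if g \<in> common S then 1 else 0)"
    by (intro sum.cong) auto
  also have "\<dots> = (\<Sum>S\<in>?P. \<Sum>g\<in>carrier G. if g \<in> common S then 1 else 0)"
    by (rule sum.swap)
  also have "\<dots> = (\<Sum>S\<in>?P. card (common S))"
  proof (rule sum.cong[OF refl])
    fix S
    have "(\<Sum>g\<in>carrier G. if g \<in> common S then 1 else 0) = card {g \<in> carrier G. g \<in> common S}"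
      using finite_carrier by (rule card_filter_eq_sum[symmetric])
    also have "{g \<in> carrier G. g \<in> common S} = common S" by (auto simp: common_def)
    finally show "(\<Sum>g\<in>carrier G. if g \<in> common S then 1 else 0) = card (common S)" .
  qed
  finally show ?thesis .
qed

text \<open>The hypothesis says that any \<open>j\<close> members are independent, that is, meet in
  a subgroup of index \<open>p ^ j\<close>.\<close>

lemma uniform_moment:
  assumes "\<And>S. S \<subseteq> C \<Longrightarrow> card S = j \<Longrightarrow> p ^ j * card (common S) = card (carrier G)"
  shows "p ^ j * (\<Sum>g\<in>carrier G. card (zeros g) choose j) = (card C choose j) * card (carrier G)"
proof -
  have "p ^ j * (\<Sum>g\<in>carrier G. card (zeros g) choose j)
      = (\<Sum>S | S \<subseteq> C \<and> card S = j. p ^ j * card (common S))"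
    by (simp add: sum_choose_zeros sum_distrib_left)
  also have "\<dots> = (\<Sum>S | S \<subseteq> C \<and> card S = j. card (carrier G))"
    using assms by (intro sum.cong) auto
  also have "\<dots> = (card C choose j) * card (carrier G)"
    by (simp add: n_subsets finite_cover)
  finally show ?thesis .
qed

lemma common_singleton: "M \<in> C \<Longrightarrow> common {M} = M"
  using subgroup_member[of M] by (auto simp: common_def subgroup.mem_carrier)

lemma common_empty: "common {} = carrier G"
  by (simp add: common_def)

lemma member_not_subset: "M \<in> C \<Longrightarrow> N \<in> C \<Longrightarrow> M \<subseteq> N \<Longrightarrow> M = N"
  using priv_mem_iff by blast

lemma card_pair:
  assumes "M \<in> C" "N \<in> C" "M \<noteq> N"
  shows "card (carrier G) = p ^ 2 * card (M \<inter> N)"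
proof -
  have "card M = p * card (M \<inter> N)"
    using assms member_not_subset
    by (intro card_Int_maximal[OF subgroup_member maximal_member]) blast+
  then show ?thesis using card_maximal[OF maximal_member[OF assms(1)]] by (simp add: power2_eq_square)
qed

lemma moment_1: "p * (\<Sum>g\<in>carrier G. card (zeros g)) = card C * card (carrier G)"
proof -
  have "p ^ 1 * card (common S) = card (carrier G)" if S: "S \<subseteq> C" "card S = 1" for S
  proof -
    obtain M where "S = {M}" using S(2) by (rule card_1_singletonE)
    moreover from this have "M \<in> C" using S(1) by simp
    ultimately show ?thesis using card_maximal[OF maximal_member, of M] by (simp add: common_singleton)
  qed
  from uniform_moment[OF this] show ?thesis by simp
qed

lemma moment_2:
  "p ^ 2 * (\<Sum>g\<in>carrier G. card (zeros g) choose 2) = (card C choose 2) * card (carrier G)"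
proof (rule uniform_moment)
  fix S assume "S \<subseteq> C" "card S = 2"
  then obtain M N where S: "S = {M, N}" "M \<noteq> N" "M \<in> C" "N \<in> C"
    by (auto simp: card_2_iff)
  then have "common S = M \<inter> N"
    using common_singleton[OF S(4)] common_insert[of M "{N}"] by auto
  then show "p ^ 2 * card (common S) = card (carrier G)"
    using card_pair[OF S(3,4,2)] by simp
qed

text \<open>For \<open>p = 2\<close> two elements outside a member have their product inside it. So
  the product of \<open>priv M0\<close> and \<open>priv M\<close> lies in every member except these
  two, and each \<open>M\<close> other than \<open>M0\<close> halves the intersection reached so
  far. In the end nothing is left but the identity: an element outside \<open>M0\<close> and in all
  other members would have \<open>card C - 1\<close> zeros.\<close>

lemma order_binary:
  assumes p: "p = 2" and C: "C \<noteq> {}" and triv: "common C = {\<one>}"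
  shows "card (carrier G) = 2 ^ (card C - 1)"
proof -
  obtain M0 where M0: "M0 \<in> C" using C by blast
  have "finite S \<Longrightarrow> S \<subseteq> C - {M0} \<Longrightarrow> card (carrier G) = 2 ^ card S * card (common S)" for S
  proof (induction S rule: finite_induct)
    case empty
    then show ?case by (simp add: common_empty)
  next
    case (insert M S)
    let ?g = "priv M0 \<otimes> priv M"
    have M: "M \<in> C" "M \<noteq> M0" and S: "S \<subseteq> C" using insert.prems by auto
    have "?g \<in> N" if "N \<in> S" for N
    proof -
      have N: "N \<in> C" "N \<noteq> M0" "N \<noteq> M" using that insert by auto
      then have "priv M0 \<notin> N" "priv M \<notin> N" using M M0 priv_mem_iff by auto
      moreover obtain t where "t < p" "priv M0 \<otimes> priv M [^] t \<in> N"
        using shift_into_maximal[OF maximal_member[OF N(1)]] M M0 \<open>priv M \<notin> N\<close> priv_carrier by blast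
      ultimately show ?thesis
        using M M0 priv_carrier p by (cases "t = 0") (auto simp: less_Suc_eq numeral_2_eq_2)
    qed
    then have "?g \<in> common S" using M M0 priv_carrier by (auto simp: common_def)
    moreover have "?g \<notin> M"
      using M M0 priv_carrier priv_mem_iff subgroup_member
        subgroup_mult_cancel[of M "priv M" "priv M0"] by (simp add: m_comm)
    ultimately have "card (common S) = 2 * card (common S \<inter> M)"
      using card_Int_maximal[OF subgroup_common_sub[OF S] maximal_member[OF M(1)]] p by auto
    then show ?case using insert by (simp add: common_insert)
  qed
  from this[of "C - {M0}"] have "card (carrier G) = 2 ^ (card C - 1) * card (common (C - {M0}))"
    using M0 finite_cover by simp
  moreover have "common (C - {M0}) = {\<one>}"
  proof -
    have "g \<in> M0" if g: "g \<in> common (C - {M0})" for g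
    proof (rule ccontr)
      assume "g \<notin> M0"
      have gc: "g \<in> carrier G" and "C - {M0} \<subseteq> zeros g" using g by (auto simp: mem_common_iff)
      then have "card (C - {M0}) \<le> card (zeros g)" by (intro card_mono finite_zeros)
      then show False
        using zeros_bound[OF gc M0 \<open>g \<notin> M0\<close>] p card_Suc_Diff1[OF finite_cover M0] by linarith
    qed
    then have "common (C - {M0}) \<subseteq> common C" by (auto simp: common_def)
    then show ?thesis using triv common_antimono[of "C - {M0}" C] by blast
  qed
  ultimately show ?thesis by simp
qed

end

section \<open>Nine hyperplanes with trivial intersection\<close>

locale nine_cover = hyperplane_cover +
  assumes card_cover: "card C = 9"
    and common_trivial: "common C = {\<one>}"
begin

lemma zeros_le:
  assumes "g \<in> carrier G" "g \<noteq> \<one>"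
  shows "card (zeros g) + p \<le> 9"
proof -
  have "zeros g \<noteq> C"
    using assms zeros_eq_imp_common common_trivial by blast
  then obtain M where "M \<in> C" "g \<notin> M" by (auto simp: zeros_def)
  then show ?thesis using zeros_bound[of g M] assms card_cover by simp
qed

lemma zeros_one_card: "card (zeros \<one>) = 9"
  by (simp add: zeros_one card_cover)

lemma sum_one: "(\<Sum>g\<in>carrier G. if g = \<one> then a else 0) = a"
  using finite_carrier by simp

lemma p_cases: "p \<in> {2, 3, 5, 7}"
proof -
  have "p \<le> 9" using p_le_card card_cover by force
  then have "p \<in> {..9}" by simp
  also have "{..9::nat} = {0, 1, 2, 3, 4, 5, 6, 7, 8, 9}" by (auto simp: numeral_eq_Suc le_Suc_eq)
  finally have cases: "p \<in> {0, 1, 2, 3, 4, 5, 6, 7, 8, 9}" .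
  have "d = 1 \<or> d = p" if "d dvd p" for d
    using that prime_p by (simp add: prime_nat_iff)
  from this[of 2] this[of 3] have "p \<noteq> 4" "p \<noteq> 6" "p \<noteq> 8" "p \<noteq> 9" by auto
  then show ?thesis using cases p_ge_2 by auto
qed

section \<open>Counting for \<open>p = 7\<close> and \<open>p = 5\<close>\<close>

lemma p_neq_7: "p \<noteq> 7"
proof
  assume p: "p = 7"
  let ?z = "\<lambda>g. card (zeros g)"
  \<comment> \<open>The polynomial is \<open>(z - 1) * (z - 2) / 2\<close>, zero at the possible
    values 1 and 2 and equal to 28 at \<open>z = 9\<close>.\<close>
  have "(?z g choose 2) + 1 = ?z g + (if g = \<one> then 28 else 0)" if g: "g \<in> carrier G" for g
  proof (cases "g = \<one>")
    case True
    then show ?thesis by (simp add: zeros_one_card choose_two)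
  next
    case False
    then have "?z g = 1 \<or> ?z g = 2" using zeros_le[OF g] zeros_pos[OF g] p by arith
    then show ?thesis using False by (auto simp: choose_two)
  qed
  then have "(\<Sum>g\<in>carrier G. (?z g choose 2) + 1)
      = (\<Sum>g\<in>carrier G. ?z g + (if g = \<one> then 28 else 0))"
    by (rule sum.cong[OF refl])
  then have "(\<Sum>g\<in>carrier G. ?z g choose 2) + card (carrier G) = (\<Sum>g\<in>carrier G. ?z g) + 28"
    by (simp only: sum.distrib sum_one card_eq_sum)
  moreover have "49 * (\<Sum>g\<in>carrier G. ?z g choose 2) = 36 * card (carrier G)"
    using moment_2 by (simp add: p card_cover choose_two)
  moreover have "7 * (\<Sum>g\<in>carrier G. ?z g) = 9 * card (carrier G)"
    using moment_1 by (simp add: p card_cover)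
  ultimately have "11 * card (carrier G) = 686" by linarith
  then show False by presburger
qed

lemma obtain_pair:
  obtains M N where "M \<in> C" "N \<in> C" "M \<noteq> N"
proof -
  have "2 \<le> card C" by (simp add: card_cover)
  then obtain T where "T \<subseteq> C" "card T = 2" by (meson obtain_subset_with_card_n)
  then show thesis using that by (auto simp: card_2_iff)
qed

text \<open>In order 25 distinct members share only the identity, so the incidences number 24 + 9 =
  33, whereas nine members of order 5 require 45.\<close>

lemma order_neq_p_squared:
  assumes "p = 5"
  shows "card (carrier G) \<noteq> 25"
proof
  assume N: "card (carrier G) = 25"
  have "card (zeros g) = 1 + (if g = \<one> then 8 else 0)" if g: "g \<in> carrier G" for g
  proof (cases "g = \<one>")
    case False
    have "\<not> 2 \<le> card (zeros g)"
    proof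
      assume "2 \<le> card (zeros g)"
      then obtain T where "T \<subseteq> zeros g" "card T = 2" by (meson obtain_subset_with_card_n)
      then obtain M N where MN: "M \<in> C" "N \<in> C" "M \<noteq> N" "g \<in> M \<inter> N"
        by (auto simp: card_2_iff zeros_def)
      then have "card (M \<inter> N) = 1" using card_pair[OF MN(1-3)] N assms by simp
      moreover have "\<one> \<in> M \<inter> N" using MN subgroup_member subgroup.one_closed by blast
      ultimately show False using MN(4) False by (metis card_1_singletonE singletonD)
    qed
    then show ?thesis using zeros_pos[OF g] False by simp
  qed (simp add: zeros_one_card)
  then have "(\<Sum>g\<in>carrier G. card (zeros g)) = (\<Sum>g\<in>carrier G. 1 + (if g = \<one> then 8 else 0))"
    by (rule sum.cong[OF refl])
  also have "\<dots> = card (carrier G) + 8"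
    by (simp only: sum.distrib sum_one card_eq_sum)
  finally have "(\<Sum>g\<in>carrier G. card (zeros g)) = 33" using N by simp
  then show False using moment_1 N assms card_cover by simp
qed

text \<open>Four members of index 5 leave at least a fifth of the group outside them. From order 625
  on these are at least 125 elements, too many for 120 bijections.\<close>

lemma order_5_le:
  assumes p: "p = 5"
  shows "card (carrier G) < 625"
proof (rule ccontr)
  assume "\<not> card (carrier G) < 625"
  then have N: "625 \<le> card (carrier G)" by simp
  let ?z = "\<lambda>g. card (zeros g)"
  have m2: "25 * (\<Sum>g\<in>carrier G. ?z g choose 2) = 36 * card (carrier G)"
    using moment_2 by (simp add: p card_cover choose_two)
  have m1: "5 * (\<Sum>g\<in>carrier G. ?z g) = 9 * card (carrier G)"
    using moment_1 by (simp add: p card_cover)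
  have "\<exists>x\<in>carrier G. x \<noteq> \<one> \<and> ?z x = 4"
  proof (rule ccontr)
    assume no: "\<not> (\<exists>x\<in>carrier G. x \<noteq> \<one> \<and> ?z x = 4)"
    \<comment> \<open>The polynomial is \<open>(z - 1) * (z - 3)\<close>, which is at most 0 for
      \<open>z\<close> from 1 to 3 and equals 48 at \<open>z = 9\<close>.\<close>
    have "2 * (?z g choose 2) + 3 \<le> 3 * ?z g + (if g = \<one> then 48 else 0)" if g: "g \<in> carrier G" for g
    proof (cases "g = \<one>")
      case True
      then show ?thesis by (simp add: zeros_one_card choose_two)
    next
      case False
      then have "?z g = 1 \<or> ?z g = 2 \<or> ?z g = 3"
        using zeros_le[OF g] zeros_pos[OF g] p no g by force
      then show ?thesis using False by (auto simp: choose_two)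
    qed
    then have "(\<Sum>g\<in>carrier G. 2 * (?z g choose 2) + 3)
        \<le> (\<Sum>g\<in>carrier G. 3 * ?z g + (if g = \<one> then 48 else 0))"
      by (rule sum_mono)
    then have "2 * (\<Sum>g\<in>carrier G. ?z g choose 2) + 3 * card (carrier G)
        \<le> 3 * (\<Sum>g\<in>carrier G. ?z g) + 48"
      by (simp add: sum.distrib sum_one sum_distrib_left[symmetric] mult.commute)
    then show False using m1 m2 N by linarith
  qed
  then obtain x where x: "x \<in> carrier G" "x \<noteq> \<one>" "?z x = 4" by blast
  let ?Z = "zeros x" and ?J = "C - zeros x"
  have J: "card ?J = 5" "finite ?J"
    using x card_cover finite_cover by (simp_all add: card_Diff_subset finite_zeros zeros_subset)
  define Y where "Y = {y \<in> carrier G. \<forall>K\<in>?Z. y \<notin> K}"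
  have "finite K" if "K \<in> ?Z" for K
    using that zeros_subset subgroup_member finite_subgroup by blast
  then have finZ: "finite (\<Union>?Z)" by (intro finite_Union finite_zeros)
  have "carrier G \<subseteq> Y \<union> \<Union>?Z" by (auto simp: Y_def)
  then have "card (carrier G) \<le> card (Y \<union> \<Union>?Z)"
    using finite_carrier finZ by (intro card_mono finite_UnI) (simp_all add: Y_def)
  also have "\<dots> \<le> card Y + card (\<Union>?Z)" by (rule card_Un_le)
  also have "card (\<Union>?Z) \<le> (\<Sum>K\<in>?Z. card K)" by (rule card_Union_le_sum_card)
  finally have "card (carrier G) \<le> card Y + (\<Sum>K\<in>?Z. card K)" by simp
  moreover have "5 * (\<Sum>K\<in>?Z. card K) = 4 * card (carrier G)"
  proof -
    have "5 * (\<Sum>K\<in>?Z. card K) = (\<Sum>K\<in>?Z. card (carrier G))"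
      unfolding sum_distrib_left
    proof (rule sum.cong[OF refl])
      fix K assume "K \<in> ?Z"
      then have "maximal_subgroup K G" using zeros_subset maximal_member by blast
      then show "5 * card K = card (carrier G)" using card_maximal[of K] p by simp
    qed
    then show ?thesis using x(3) by simp
  qed
  ultimately have Ycard: "125 \<le> card Y" using N by linarith
  have "\<exists>f. inj_on f {..<5} \<and> (\<forall>t<5. f t \<in> ?J \<and> y \<otimes> x [^] (t::nat) \<in> f t)" if "y \<in> Y" for y
  proof -
    have "y \<in> carrier G" "\<And>K. K \<in> ?Z \<Longrightarrow> y \<notin> K" using that by (auto simp: Y_def)
    from shifts_avoid_zeros[OF x(1) this] p show ?thesis by (metis (no_types, lifting))
  qed
  then obtain f where f: "\<And>y. y \<in> Y \<Longrightarrow> inj_on (f y) {..<5::nat}"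
    "\<And>y t. y \<in> Y \<Longrightarrow> t < 5 \<Longrightarrow> f y t \<in> ?J \<and> y \<otimes> x [^] t \<in> f y t" by metis
  \<comment> \<open>Bijections onto \<open>?J\<close> are written as lists of distinct members,
    indexed by the exponent of \<open>x\<close>.\<close>
  let ?L = "{xs. length xs = 5 \<and> distinct xs \<and> set xs \<subseteq> ?J}"
  have "inj_on (\<lambda>y. map (f y) [0..<5]) Y"
  proof (rule inj_onI)
    fix y y' assume y: "y \<in> Y" "y' \<in> Y" and "map (f y) [0..<5] = map (f y') [0..<5]"
    then have e: "f y t = f y' t" if "t < 5" for t using that by simp
    have yc: "y \<in> carrier G" "y' \<in> carrier G" using y by (auto simp: Y_def)
    \<comment> \<open>If \<open>y\<close> and \<open>y'\<close> have the same list, their quotient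
      lies in all five members of \<open>?J\<close>, and only the identity has more than four
      zeros.\<close>
    have "f y ` {..<5} \<subseteq> zeros (inv y' \<otimes> y)"
    proof
      fix K assume "K \<in> f y ` {..<5}"
      then obtain t where t: "t < 5" "K = f y t" by blast
      have K: "K \<in> C" "subgroup K G" "y \<otimes> x [^] t \<in> K" "y' \<otimes> x [^] t \<in> K"
        using f(2)[OF y(1) t(1)] f(2)[OF y(2) t(1)] e[OF t(1)] t subgroup_member by auto
      have "(y' \<otimes> x [^] t) \<otimes> (inv y' \<otimes> y) = y \<otimes> x [^] t"
      proof -
        have "y' \<otimes> (inv y' \<otimes> y) = y" using yc by (simp add: m_assoc[symmetric])
        then show ?thesis
          using yc x by (simp add: m_comm[of y' "x [^] t"] m_assoc m_comm[of y "x [^] t"])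
      qed
      then have "inv y' \<otimes> y \<in> K" using subgroup_mult_cancel[OF K(2,4), of "inv y' \<otimes> y"] K(3) yc by simp
      then show "K \<in> zeros (inv y' \<otimes> y)" using K by (simp add: zeros_def)
    qed
    then have "card (f y ` {..<5}) \<le> ?z (inv y' \<otimes> y)" by (intro card_mono finite_zeros)
    then have "5 \<le> ?z (inv y' \<otimes> y)" using f(1)[OF y(1)] by (simp add: card_image)
    then have "inv y' \<otimes> y = \<one>"
      using zeros_le[of "inv y' \<otimes> y"] yc p by force
    then show "y = y'" using yc by (metis inv_closed inv_equality inv_inv)
  qed
  moreover have "(\<lambda>y. map (f y) [0..<5]) ` Y \<subseteq> ?L"
    using f by (auto simp: distinct_map atLeast0LessThan)
  moreover have "finite ?L"
    using finite_lists_length_eq[OF J(2), of 5] by (rule finite_subset[rotated]) auto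
  ultimately have "card Y \<le> card ?L" by (rule card_inj_on_le)
  also have "card ?L = \<Prod>{5 - 5 + 1..5}"
    using card_lists_distinct_length_eq[OF J(2), of 5] J(1) by simp
  also have "\<dots> = 120" by (simp add: numeral_eq_Suc atLeastAtMostSuc_conv)
  finally show False using Ycard by simp
qed

end

section \<open>Lower bound on the order for \<open>p = 3\<close>\<close>

context elementary_abelian
begin

lemma mult_div_cancel:
  assumes "x \<in> carrier G" "y \<in> carrier G"
  shows "x \<otimes> y \<otimes> inv y = x" "x \<otimes> inv y \<otimes> y = x"
  using assms by (simp_all add: m_assoc)

lemma subgroup_mult_cancel_right:
  assumes "subgroup M G" "x \<in> M" "y \<in> carrier G"
  shows "y \<otimes> x \<in> M \<longleftrightarrow> y \<in> M"
  using subgroup_mult_cancel[OF assms] assms by (simp add: m_comm subgroup.mem_carrier)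

lemma subgroup_inv_mem_iff:
  assumes "subgroup M G" "x \<in> carrier G"
  shows "inv x \<in> M \<longleftrightarrow> x \<in> M"
  using assms by (metis inv_inv subgroup.m_inv_closed)

lemma exponent_three:
  assumes "p = 3" "x \<in> carrier G"
  shows "x \<otimes> x = inv x" "inv x \<otimes> inv x = x"
proof -
  have "x \<otimes> x \<otimes> x = \<one>"
    using exponent_p[OF assms(2)] assms by (simp add: numeral_3_eq_3)
  then show *: "x \<otimes> x = inv x" using assms(2) by (simp add: inv_equality)
  then show "inv x \<otimes> inv x = x" using assms(2) by (metis inv_inv inv_mult)
qed

text \<open>The nonzero residues modulo a subgroup of index 3 are plus and minus one, so
  \<open>y\<close> is congruent to \<open>x\<close> or to its inverse.\<close>

lemma coset_mod_three:
  assumes p: "p = 3" and M: "maximal_subgroup M G"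
    and x: "x \<in> carrier G" "x \<notin> M" and y: "y \<in> carrier G" "y \<notin> M"
  shows "y \<otimes> x \<in> M \<or> y \<otimes> inv x \<in> M"
proof -
  obtain t :: nat where t: "t < 3" "y \<otimes> x [^] t \<in> M" using shift_into_maximal[OF M x y(1)] p by blast
  then have "t = 0 \<or> t = 1 \<or> t = 2" by auto
  then show ?thesis using t x y exponent_three(1)[OF p x(1)] by (auto simp: numeral_2_eq_2)
qed

end

context nine_cover
begin

lemma card_triple:
  assumes "M \<in> C" "N \<in> C" "K \<in> C" "M \<noteq> N" "\<not> M \<inter> N \<subseteq> K"
  shows "card (carrier G) = p ^ 3 * card (M \<inter> N \<inter> K)"
proof -
  have "subgroup (M \<inter> N) G" using assms subgroup_member by (simp add: subgroups_Inter_pair)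
  then have "card (M \<inter> N) = p * card (M \<inter> N \<inter> K)"
    using card_Int_maximal maximal_member assms by blast
  then show ?thesis using card_pair[OF assms(1,2,4)] by (simp add: power3_eq_cube power2_eq_square)
qed

text \<open>The cubic with roots 1, 3 and 4 is nonnegative at every positive integer. By the moments
  its average over the group is 8/3, while the identity alone contributes 240; this gives 90, which
  is just enough to exclude 81.\<close>

lemma order_3_ge_noncollinear:
  assumes p: "p = 3"
    and nc: "\<And>M N K. M \<in> C \<Longrightarrow> N \<in> C \<Longrightarrow> K \<in> C \<Longrightarrow> M \<noteq> N \<Longrightarrow> M \<noteq> K \<Longrightarrow> N \<noteq> K \<Longrightarrow> \<not> M \<inter> N \<subseteq> K"
  shows "90 \<le> card (carrier G)"
proof -
  let ?z = "\<lambda>g. card (zeros g)"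
  have "p ^ 3 * (\<Sum>g\<in>carrier G. ?z g choose 3) = (card C choose 3) * card (carrier G)"
  proof (rule uniform_moment)
    fix S assume S: "S \<subseteq> C" "card S = 3"
    then obtain M N K where S': "S = {M, N, K}" "M \<noteq> N" "M \<noteq> K" "N \<noteq> K"
      by (auto simp: card_3_iff)
    have "common S = M \<inter> N \<inter> K"
      using S S' subgroup_member[of M] by (auto simp: common_def subgroup.mem_carrier)
    then show "p ^ 3 * card (common S) = card (carrier G)"
      using card_triple[of M N K] nc[of M N K] S S' by simp
  qed
  moreover have "9 choose 3 = (84::nat)" by (simp add: eval_nat_numeral)
  ultimately have m3: "27 * (\<Sum>g\<in>carrier G. ?z g choose 3) = 84 * card (carrier G)"
    by (simp add: p card_cover)
  have m2: "9 * (\<Sum>g\<in>carrier G. ?z g choose 2) = 36 * card (carrier G)"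
    using moment_2 by (simp add: p card_cover choose_two)
  have m1: "3 * (\<Sum>g\<in>carrier G. ?z g) = 9 * card (carrier G)"
    using moment_1 by (simp add: p card_cover)
  \<comment> \<open>\<open>6 * (z choose 3) - 10 * (z choose 2) + 12 * z - 12 = (z - 1) * (z - 3) * (z - 4)\<close>\<close>
  have "10 * (?z g choose 2) + 12 + (if g = \<one> then 240 else 0) \<le> 6 * (?z g choose 3) + 12 * ?z g"
    if g: "g \<in> carrier G" for g
  proof (cases "g = \<one>")
    case True
    then show ?thesis by (simp add: zeros_one_card choose_two) (simp add: eval_nat_numeral)
  next
    case False
    then have "?z g \<in> {1, 2, 3, 4, 5, 6}"
      using zeros_le[OF g] zeros_pos[OF g] p by (simp) linarith
    then show ?thesis using False by (auto simp: eval_nat_numeral)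
  qed
  then have "(\<Sum>g\<in>carrier G. 10 * (?z g choose 2) + 12 + (if g = \<one> then 240 else 0))
      \<le> (\<Sum>g\<in>carrier G. 6 * (?z g choose 3) + 12 * ?z g)"
    by (rule sum_mono)
  then have "10 * (\<Sum>g\<in>carrier G. ?z g choose 2) + 12 * card (carrier G) + 240
      \<le> 6 * (\<Sum>g\<in>carrier G. ?z g choose 3) + 12 * (\<Sum>g\<in>carrier G. ?z g)"
    by (simp add: sum.distrib sum_one sum_distrib_left mult.commute)
  then show ?thesis using m1 m2 m3 by linarith
qed

text \<open>The private elements of the six other members can be moved, by inversion, into one coset
  \<open>A\<close> of \<open>?L\<close>. Six distinct elements force \<open>A\<close> to have nine,
  so it is an affine plane of order 3 in which each of the six members cuts out a line: one private
  point and two points of the three-element rest \<open>R\<close>. Two members then share both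
  points in \<open>R\<close>, hence the whole line, including a private point.\<close>

lemma order_3_collinear:
  assumes p: "p = 3" and N: "card (carrier G) = 3 ^ e" "e \<le> 4"
    and abc: "Ma \<in> C" "Mb \<in> C" "Mc \<in> C" "Ma \<noteq> Mb" "Ma \<noteq> Mc" "Mb \<noteq> Mc"
    and col: "Ma \<inter> Mb \<subseteq> Mc"
  shows False
proof -
  let ?L = "Ma \<inter> Mb"
  have sL: "subgroup ?L G" using abc subgroup_member by (simp add: subgroups_Inter_pair)
  have finL: "finite ?L" using finite_subgroup[OF sL] .
  have cL: "3 ^ e = 9 * card ?L" using card_pair[OF abc(1,2,4)] N p by simp
  have ac: "Ma \<inter> Mc = ?L"
  proof -
    have "card (Ma \<inter> Mc) = card ?L"
      using card_pair[OF abc(1,2,4)] card_pair[OF abc(1,3,5)] p by simp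
    moreover have "finite (Ma \<inter> Mc)" using abc subgroup_member finite_subgroup by blast
    moreover have "?L \<subseteq> Ma \<inter> Mc" using col by blast
    ultimately show ?thesis by (metis card_subset_eq)
  qed
  have bc: "Mb \<inter> Mc = ?L"
  proof -
    have "card (Mb \<inter> Mc) = card ?L"
      using card_pair[OF abc(1,2,4)] card_pair[OF abc(2,3,6)] p by simp
    moreover have "finite (Mb \<inter> Mc)" using abc subgroup_member finite_subgroup by blast
    moreover have "?L \<subseteq> Mb \<inter> Mc" using col by blast
    ultimately show ?thesis by (metis card_subset_eq)
  qed
  let ?C' = "C - {Ma, Mb, Mc}"
  have C': "card ?C' = 6" "finite ?C'"
    using abc card_cover finite_cover by (simp_all add: card_Diff_subset)
  from C'(1) have "?C' \<noteq> {}" by (metis card.empty zero_neq_numeral)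
  then obtain M1 where M1: "M1 \<in> ?C'" by blast
  let ?u = "priv M1"
  have u: "?u \<in> carrier G" "?u \<notin> Ma" "?u \<notin> Mb" "?u \<notin> Mc"
    using M1 abc priv_carrier priv_mem_iff by auto
  define A where "A = {y \<in> carrier G. y \<otimes> inv ?u \<in> ?L}"
  have A_div: "x \<otimes> inv y \<in> ?L" if "x \<in> A" "y \<in> A" for x y
  proof -
    have xy: "x \<in> carrier G" "y \<in> carrier G" "x \<otimes> inv ?u \<in> ?L" "y \<otimes> inv ?u \<in> ?L"
      using that by (auto simp: A_def)
    then have "(x \<otimes> inv ?u) \<otimes> inv (y \<otimes> inv ?u) \<in> ?L"
      using sL by (meson subgroup.m_closed subgroup.m_inv_closed)
    also have "(x \<otimes> inv ?u) \<otimes> inv (y \<otimes> inv ?u) = x \<otimes> inv y"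
    proof -
      have "inv ?u \<otimes> (?u \<otimes> inv y) = inv y" using xy u by (simp add: m_assoc[symmetric])
      then show ?thesis using xy u by (simp add: inv_mult_group m_assoc)
    qed
    finally show ?thesis .
  qed
  have A_mult: "l \<otimes> x \<in> A" if "x \<in> A" "l \<in> ?L" for x l
  proof -
    have lx: "l \<in> carrier G" "x \<in> carrier G" "x \<otimes> inv ?u \<in> ?L"
      using that subgroup.mem_carrier[OF sL] by (auto simp: A_def)
    then have "l \<otimes> (x \<otimes> inv ?u) \<in> ?L" using subgroup.m_closed[OF sL that(2)] by blast
    then show ?thesis using lx u by (simp add: A_def m_assoc)
  qed
  have card_A_Int: "card (M \<inter> A) = card (M \<inter> ?L)" if M: "subgroup M G" and d: "d \<in> M" "d \<in> A" for M d
  proof -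
    have dc: "d \<in> carrier G" using d by (simp add: A_def)
    have "(\<lambda>l. l \<otimes> d) ` (M \<inter> ?L) = M \<inter> A"
    proof
      show "(\<lambda>l. l \<otimes> d) ` (M \<inter> ?L) \<subseteq> M \<inter> A"
        using d A_mult subgroup.m_closed[OF M] by blast
      show "M \<inter> A \<subseteq> (\<lambda>l. l \<otimes> d) ` (M \<inter> ?L)"
      proof
        fix x assume x: "x \<in> M \<inter> A"
        then have "x \<otimes> inv d \<in> M \<inter> ?L"
          using A_div[of x d] d subgroup.m_closed[OF M] subgroup.m_inv_closed[OF M] by blast
        moreover have "x = (x \<otimes> inv d) \<otimes> d"
          using x dc mult_div_cancel(2)[of x d] by (simp add: A_def)
        ultimately show "x \<in> (\<lambda>l. l \<otimes> d) ` (M \<inter> ?L)" by (rule rev_image_eqI)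
      qed
    qed
    moreover have "inj_on (\<lambda>l. l \<otimes> d) (M \<inter> ?L)"
      using dc subgroup.mem_carrier[OF M] by (intro inj_onI) simp
    ultimately show ?thesis by (metis card_image)
  qed
  have uA: "?u \<in> A" using u(1) subgroup.one_closed[OF sL] by (simp add: A_def)
  have A_carrier: "A \<subseteq> carrier G" by (auto simp: A_def)
  have cardA: "card A = card ?L"
    using card_A_Int[OF subgroup_self u(1) uA] A_carrier subgroup.subset[OF sL]
    by (simp add: Int_absorb1)
  have finA: "finite A" using A_carrier finite_carrier by (rule finite_subset)
  \<comment> \<open>Modulo \<open>Ma \<inter> Mb\<close> the group is \<open>C\<^sub>3 \<times> C\<^sub>3\<close>, and everything outside the three lines
      \<open>Ma\<close>, \<open>Mb\<close>, \<open>Mc\<close> lies on the fourth one.\<close>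
  have "\<exists>d\<in>A. \<forall>K\<in>C. d \<in> K \<longleftrightarrow> K = M" if M: "M \<in> ?C'" for M
  proof -
    let ?c = "priv M"
    have c: "?c \<in> carrier G" "?c \<notin> Ma" "?c \<notin> Mb" "?c \<notin> Mc"
      using M abc priv_carrier priv_mem_iff by auto
    have "?c \<otimes> ?u \<in> K \<or> ?c \<otimes> inv ?u \<in> K" if "K \<in> {Ma, Mb, Mc}" for K
      using that coset_mod_three[OF p maximal_member u(1) _ c(1)] u c abc by auto
    \<comment> \<open>There are three members and two signs, so one sign occurs twice, and any two
      of the three members meet in \<open>?L\<close>.\<close>
    then have "?c \<otimes> ?u \<in> ?L \<or> ?c \<otimes> inv ?u \<in> ?L"
      using ac bc by blast
    then show ?thesis
    proof
      assume "?c \<otimes> inv ?u \<in> ?L"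
      then have "?c \<in> A" using c by (simp add: A_def)
      then show ?thesis using M priv_mem_iff[of M] by (intro bexI[of _ ?c]) auto
    next
      \<comment> \<open>Here \<open>priv M\<close> lies in the opposite coset; its inverse lies in
        \<open>A\<close> and in the same members.\<close>
      assume "?c \<otimes> ?u \<in> ?L"
      then have "inv (?c \<otimes> ?u) \<in> ?L" by (rule subgroup.m_inv_closed[OF sL])
      then have "inv ?c \<in> A" using c u by (simp add: A_def inv_mult)
      moreover have "inv ?c \<in> K \<longleftrightarrow> K = M" if "K \<in> C" for K
        using that M c priv_mem_iff[of M K] subgroup_inv_mem_iff subgroup_member by simp
      ultimately show ?thesis by blast
    qed
  qed
  then obtain d where d: "\<And>M. M \<in> ?C' \<Longrightarrow> d M \<in> A"
    "\<And>M K. M \<in> ?C' \<Longrightarrow> K \<in> C \<Longrightarrow> d M \<in> K \<longleftrightarrow> K = M" by metis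
  have inj_d: "inj_on d ?C'"
  proof (rule inj_onI)
    fix M N assume MN: "M \<in> ?C'" "N \<in> ?C'" "d M = d N"
    then show "M = N" using d(2)[OF MN(1), of M] d(2)[OF MN(2), of M] by simp
  qed
  have dA: "d ` ?C' \<subseteq> A" using d(1) by blast
  have "6 \<le> card ?L"
    using card_mono[OF finA dA] inj_d C'(1) cardA by (simp add: card_image)
  moreover have "card ?L \<in> {1, 3, 9}"
  proof -
    have "e = 2 \<or> e = 3 \<or> e = 4"
    proof -
      have "(3::nat) ^ e \<noteq> 1" "(3::nat) ^ e \<noteq> 3" using cL by presburger+
      then have "e \<noteq> 0" "e \<noteq> 1" by auto
      then show ?thesis using N(2) by linarith
    qed
    then show ?thesis using cL by auto
  qed
  ultimately have L9: "card ?L = 9" by auto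
  define R where "R = A - d ` ?C'"
  have cR: "card R = 3" "finite R"
    using dA finA inj_d C' cardA L9 unfolding R_def
    by (simp_all add: card_Diff_subset finite_subset card_image)
  have MA: "M \<inter> A = insert (d M) (M \<inter> R)" "d M \<notin> R" "card (M \<inter> R) = 2" if M: "M \<in> ?C'" for M
  proof -
    have sM: "subgroup M G" and mM: "maximal_subgroup M G" using M subgroup_member maximal_member by auto
    have dM: "d M \<in> M" "d M \<in> A" using d(2)[OF M, of M] d(1)[OF M] M by auto
    have "M' = M" if "M' \<in> ?C'" "d M' \<in> M" for M' using d(2)[OF that(1), of M] that(2) M by simp
    then show *: "M \<inter> A = insert (d M) (M \<inter> R)" using dM unfolding R_def by blast
    show **: "d M \<notin> R" using M by (simp add: R_def)
    \<comment> \<open>Otherwise \<open>M\<close> would contain all of \<open>A\<close>, and with it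
      the private points of the other members.\<close>
    have "\<not> ?L \<subseteq> M"
    proof
      assume LM: "?L \<subseteq> M"
      have "card (?C' - {M}) = 5" using C' M by simp
      then have "?C' - {M} \<noteq> {}" by (metis card.empty zero_neq_numeral)
      then obtain M' where M': "M' \<in> ?C'" "M' \<noteq> M" by blast
      have "d M' \<otimes> inv (d M) \<in> M" using A_div d(1) M M' LM by blast
      then have "d M' \<otimes> inv (d M) \<otimes> d M \<in> M" using subgroup.m_closed[OF sM] dM(1) by blast
      moreover have "d M' \<in> carrier G" "d M \<in> carrier G"
        using d(1)[OF M] d(1)[OF M'(1)] A_carrier by blast+
      ultimately have "d M' \<in> M" by (simp add: mult_div_cancel)
      then show False using d(2)[OF M'(1), of M] M M'(2) by blast
    qed
    then have "card (M \<inter> ?L) = 3"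
      using card_Int_maximal[OF sL mM] L9 p by (simp add: Int_commute)
    then have "card (insert (d M) (M \<inter> R)) = 3"
      using card_A_Int[OF sM dM] * by simp
    then show "card (M \<inter> R) = 2" using ** cR by simp
  qed
  \<comment> \<open>Six members compete for the three pairs in \<open>R\<close>.\<close>
  have "\<not> inj_on (\<lambda>M. M \<inter> R) ?C'"
  proof
    assume "inj_on (\<lambda>M. M \<inter> R) ?C'"
    moreover have "(\<lambda>M. M \<inter> R) ` ?C' \<subseteq> {T. T \<subseteq> R \<and> card T = 2}" using MA(3) by auto
    moreover have "finite {T. T \<subseteq> R \<and> card T = 2}" using cR by simp
    ultimately have "card ?C' \<le> card {T. T \<subseteq> R \<and> card T = 2}" by (rule card_inj_on_le)
    then show False using C' cR by (simp add: n_subsets choose_two)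
  qed
  then obtain M M' where M: "M \<in> ?C'" "M' \<in> ?C'" "M \<noteq> M'" and eq: "M \<inter> R = M' \<inter> R"
    unfolding inj_on_def by blast
  obtain r r' where r: "M \<inter> R = {r, r'}" "r \<noteq> r'" using MA(3)[OF M(1)] by (auto simp: card_2_iff)
  have rA: "r \<in> A" "r' \<in> A" "r \<in> M" "r' \<in> M" "r \<in> M'" "r' \<in> M'"
    using r eq by (auto simp: R_def)
  have rc: "r \<in> carrier G" "r' \<in> carrier G" using rA A_carrier by auto
  \<comment> \<open>The third point of the affine line through \<open>r\<close> and
    \<open>r'\<close>, additively 2r' - r; it lies in every subgroup containing both.\<close>
  let ?s = "r' \<otimes> inv r \<otimes> r'"
  have sA: "?s \<in> A" using A_mult A_div rA by blast
  have sM: "?s \<in> M" "?s \<in> M'"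
  proof -
    have "subgroup M G" "subgroup M' G" using M subgroup_member by blast+
    then show "?s \<in> M" "?s \<in> M'"
      using rA by (simp_all add: subgroup.m_closed subgroup.m_inv_closed)
  qed
  have "?s \<noteq> d M"
  proof
    assume "?s = d M"
    then have "d M \<in> M'" using sM(2) by simp
    then show False using d(2)[OF M(1), of M'] M by blast
  qed
  then have "?s = r \<or> ?s = r'" using MA(1)[OF M(1)] sA sM r by blast
  then show False
  proof
    assume "?s = r'"
    then have "r' \<otimes> inv r = \<one>" using rc by (metis inv_closed m_closed r_cancel_one)
    then show False using rc r(2) by (metis inv_closed inv_equality inv_inv)
  next
    assume "?s = r"
    then have "r' \<otimes> r' \<otimes> inv r = r" using rc by (simp add: m_ac)
    then have "r' \<otimes> r' = r \<otimes> r" using rc by (metis m_closed mult_div_cancel(2))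
    then have "inv r' = inv r" using exponent_three(1)[OF p] rc by simp
    then show False using rc r(2) by (metis inv_inv)
  qed
qed

lemma order_3_ge:
  assumes "p = 3" "card (carrier G) = 3 ^ e"
  shows "5 \<le> e"
proof (rule ccontr)
  assume "\<not> 5 \<le> e"
  then have e: "e \<le> 4" by simp
  then have "(3::nat) ^ e \<le> 3 ^ 4" by (intro power_increasing) auto
  then have "\<not> 90 \<le> card (carrier G)" using assms by simp
  then show False
    using order_3_ge_noncollinear[OF assms(1)] order_3_collinear[OF assms e] by blast
qed

end

section \<open>Ternary codes of length five, and kernels of functionals\<close>

context elementary_abelian
begin

lemma subgroup_div_trans:
  assumes M: "subgroup M G" and c: "x \<in> carrier G" "y \<in> carrier G" "a \<in> carrier G"
    and xy: "x \<otimes> a \<in> M" "y \<otimes> a \<in> M"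
  shows "x \<otimes> inv y \<in> M"
proof -
  have "(x \<otimes> a) \<otimes> inv (y \<otimes> a) \<in> M"
    using xy subgroup.m_closed[OF M] subgroup.m_inv_closed[OF M] by blast
  moreover have "(x \<otimes> a) \<otimes> inv (y \<otimes> a) = x \<otimes> inv y"
  proof -
    have "a \<otimes> (inv a \<otimes> inv y) = inv y" using c by (simp add: m_assoc[symmetric])
    then show ?thesis using c by (simp add: inv_mult_group m_assoc)
  qed
  ultimately show ?thesis by simp
qed

text \<open>Evaluating \<open>H\<close> at the five members gives a code in which three zeros force
  a word to be trivial, so nontrivial words have weight at least 3; the claim is that its dimension
  is at most 2. Otherwise there are words \<open>u3\<close>, \<open>u4\<close>, \<open>u5\<close>
  supported on positions 1, 2 and one further position each. Scaled to agree at position 1, two of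
  them also agree at position 2, as only two nonzero values exist; their quotient has three zeros
  without being trivial.\<close>

lemma five_maximal_bound:
  assumes p: "p = 3" and H: "subgroup H G" and D: "subgroup D G"
    and R: "card \<R> = 5" "\<And>M. M \<in> \<R> \<Longrightarrow> maximal_subgroup M G" "\<And>M. M \<in> \<R> \<Longrightarrow> D \<subseteq> M"
    and three: "\<And>g A B E. g \<in> H \<Longrightarrow> {A, B, E} \<subseteq> \<R> \<Longrightarrow> A \<noteq> B \<Longrightarrow> A \<noteq> E \<Longrightarrow> B \<noteq> E
      \<Longrightarrow> g \<in> A \<Longrightarrow> g \<in> B \<Longrightarrow> g \<in> E \<Longrightarrow> g \<in> D"
  shows "card H < 27 * card D"
proof (rule ccontr)
  assume "\<not> card H < 27 * card D"
  then have big: "27 * card D \<le> card H" by simp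
  have "finite \<R>" using R(1) by (metis card.infinite zero_neq_numeral)
  then obtain xs where xs: "set xs = \<R>" "distinct xs" using finite_distinct_list by blast
  then have "length xs = Suc (Suc (Suc (Suc (Suc 0))))" using R(1) by (simp flip: distinct_card)
  then obtain R1 R2 R3 R4 R5 where "xs = [R1, R2, R3, R4, R5]"
    by (auto simp: length_Suc_conv)
  then have Rs: "\<R> = {R1, R2, R3, R4, R5}" and dist: "distinct [R1, R2, R3, R4, R5]"
    using xs by auto
  then have dist': "distinct [R5, R4, R3, R2, R1]"
    using distinct_rev[of "[R1, R2, R3, R4, R5]"] by (simp only: rev.simps append.simps)
  have sub: "subgroup M G" if "M \<in> \<R>" for M using R(2)[OF that] by (rule maximal_imp_subgroup)
  have Hc: "g \<in> carrier G" if "g \<in> H" for g using subgroup.mem_carrier[OF H that] .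
  \<comment> \<open>Two cuts by members of index at most 3 in \<open>H\<close> leave at least
    \<open>3 * card D\<close> elements.\<close>
  have ex: "\<exists>u\<in>H \<inter> A \<inter> B. u \<notin> D" if AB: "A \<in> \<R>" "B \<in> \<R>" for A B
  proof (rule ccontr)
    assume "\<not> ?thesis"
    then have "card (H \<inter> A \<inter> B) \<le> card D" by (intro card_mono finite_subgroup D) blast
    moreover have "card (H \<inter> A) \<le> p * card (H \<inter> A \<inter> B)"
      using AB H R(2) sub by (intro card_Int_maximal_le subgroups_Inter_pair) auto
    moreover have "card H \<le> p * card (H \<inter> A)"
      using AB H R(2) by (intro card_Int_maximal_le) auto
    ultimately have "card H \<le> 9 * card D" unfolding p by linarith
    then show False using big card_subgroup_pos[OF D] by linarith
  qed
  have other: "u \<notin> K" if "u \<in> H \<inter> A \<inter> B" "u \<notin> D" "{A, B, K} \<subseteq> \<R>" "A \<noteq> B" "A \<noteq> K" "B \<noteq> K" for u A B K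
    using that three[of u A B K] by blast
  obtain u3 where u3: "u3 \<in> H \<inter> R4 \<inter> R5" "u3 \<notin> D" using ex[of R4 R5] Rs by blast
  have u3': "u3 \<notin> R1" "u3 \<notin> R2" "u3 \<notin> R3" "u3 \<in> carrier G"
    using other[OF u3, of R1] other[OF u3, of R2] other[OF u3, of R3] Rs dist dist' Hc[of u3] u3(1)
    by simp_all
  \<comment> \<open>Inverting an element if necessary, all three become congruent modulo \<open>R1\<close>.\<close>
  have norm: "\<exists>v\<in>H \<inter> A \<inter> B. v \<notin> D \<and> v \<otimes> inv u3 \<in> R1"
    if AB: "A \<in> \<R>" "B \<in> \<R>" "A \<noteq> B" "A \<noteq> R1" "B \<noteq> R1" for A B
  proof -
    obtain w where w: "w \<in> H \<inter> A \<inter> B" "w \<notin> D" using ex[OF AB(1,2)] by blast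
    have wR: "w \<notin> R1" using other[OF w, of R1] AB Rs dist dist' by simp
    have wc: "w \<in> carrier G" using Hc w(1) by blast
    have mR1: "maximal_subgroup R1 G" using R(2) Rs by blast
    consider "w \<otimes> u3 \<in> R1" | "w \<otimes> inv u3 \<in> R1"
      using coset_mod_three[OF p mR1 u3'(4,1) wc wR] by blast
    then show ?thesis
    proof cases
      case 1
      then have "inv (w \<otimes> u3) \<in> R1" using subgroup.m_inv_closed[OF sub, of R1] Rs by simp
      then have "inv w \<otimes> inv u3 \<in> R1" using wc u3' by (simp add: inv_mult)
      moreover have "inv w \<in> H \<inter> A \<inter> B" "inv w \<notin> D"
        using w wc H D sub AB by (simp_all add: subgroup_inv_mem_iff)
      ultimately show ?thesis by blast
    qed (use w in blast)
  qed
  have "\<exists>v\<in>H \<inter> R3 \<inter> R5. v \<notin> D \<and> v \<otimes> inv u3 \<in> R1"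
    by (rule norm) (use Rs dist dist' in simp_all)
  then obtain u4 where u4: "u4 \<in> H \<inter> R3 \<inter> R5" "u4 \<notin> D" "u4 \<otimes> inv u3 \<in> R1"
    by blast
  have "\<exists>v\<in>H \<inter> R3 \<inter> R4. v \<notin> D \<and> v \<otimes> inv u3 \<in> R1"
    by (rule norm) (use Rs dist dist' in simp_all)
  then obtain u5 where u5: "u5 \<in> H \<inter> R3 \<inter> R4" "u5 \<notin> D" "u5 \<otimes> inv u3 \<in> R1"
    by blast
  have u4': "u4 \<notin> R2" "u4 \<notin> R4" "u4 \<in> carrier G"
    using other[OF u4(1,2), of R2] other[OF u4(1,2), of R4] Rs dist dist' Hc[of u4] u4(1)
    by simp_all
  have u5': "u5 \<notin> R2" "u5 \<notin> R5" "u5 \<in> carrier G"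
    using other[OF u5(1,2), of R2] other[OF u5(1,2), of R5] Rs dist dist' Hc[of u5] u5(1)
    by simp_all
  \<comment> \<open>The quotient of \<open>x\<close> and \<open>y\<close> has zeros at
    \<open>R1\<close>, \<open>R2\<close> and \<open>K\<close>, so it lies in \<open>D\<close> and
    hence in \<open>J\<close>; but exactly one of \<open>x\<close> and \<open>y\<close> lies in
    \<open>J\<close>.\<close>
  have fin: False if xy: "x \<in> H \<inter> K \<inter> I" "y \<in> H \<inter> K \<inter> J" "x \<notin> J" "x \<otimes> inv y \<in> R1" "x \<otimes> inv y \<in> R2"
    and KJ: "K \<in> {R3, R4, R5}" "J \<in> {R3, R4, R5}" for x y K I J
  proof -
    have KJR: "K \<in> \<R>" "J \<in> \<R>" using KJ Rs by auto
    then have sK: "subgroup K G" "subgroup J G" and DJ: "D \<subseteq> J" using sub R(3) by blast+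
    have c: "x \<in> carrier G" "y \<in> carrier G" using xy Hc[of x] Hc[of y] by simp_all
    have "x \<otimes> inv y \<in> H" "x \<otimes> inv y \<in> K"
      using xy H sK by (simp_all add: subgroup.m_closed subgroup.m_inv_closed)
    moreover have "R1 \<noteq> K \<and> R2 \<noteq> K \<and> R1 \<noteq> R2"
      using KJ(1) dist dist' by (elim insertE emptyE) simp_all
    ultimately have "x \<otimes> inv y \<in> D"
      using three[of "x \<otimes> inv y" R1 R2 K] xy(4,5) KJ(1) Rs by simp
    then have "x \<otimes> inv y \<otimes> y \<in> J" using DJ xy(2) subgroup.m_closed[OF sK(2)] by blast
    then show False using c xy(3) by (simp add: mult_div_cancel)
  qed
  have s1: "subgroup R1 G" and s2: "subgroup R2 G" and m2: "maximal_subgroup R2 G" using sub R(2) Rs by simp_all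
  have c45: "u4 \<otimes> inv u5 \<in> R1"
    using subgroup_div_trans[OF s1 u4'(3) u5'(3) _ u4(3) u5(3)] u3' by simp
  have "u4 \<otimes> u3 \<in> R2 \<or> u4 \<otimes> inv u3 \<in> R2"
    using coset_mod_three[OF p m2 u3'(4,2) u4'(3,1)] .
  moreover have "u5 \<otimes> u3 \<in> R2 \<or> u5 \<otimes> inv u3 \<in> R2"
    using coset_mod_three[OF p m2 u3'(4,2) u5'(3,1)] .
  moreover have "u4 \<otimes> inv u5 \<in> R2" if "u4 \<otimes> u3 \<in> R2" "u5 \<otimes> u3 \<in> R2"
    using subgroup_div_trans[OF s2 u4'(3) u5'(3) u3'(4) that] .
  moreover have "u4 \<otimes> inv u3 \<notin> R2"
    using fin[of u4 R5 R3 u3 R4] u4 u4' u3 by blast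
  moreover have "u5 \<otimes> inv u3 \<notin> R2"
    using fin[of u5 R4 R3 u3 R5] u5 u5' u3 by blast
  moreover have "u4 \<otimes> inv u5 \<notin> R2"
    using fin[of u4 R3 R5 u5 R4] u4 u4' u5 c45 by blast
  ultimately show False by blast
qed

text \<open>A nonzero functional maps onto a group of prime order. Its values are natural numbers
  read modulo \<open>p\<close>, so that sums of \<open>shift\<close> values qualify.\<close>

lemma kernel_maximal:
  fixes F :: "'a \<Rightarrow> nat"
  assumes F: "\<And>y z. y \<in> carrier G \<Longrightarrow> z \<in> carrier G \<Longrightarrow> F (y \<otimes> z) mod p = (F y + F z) mod p"
    and nontriv: "\<exists>g\<in>carrier G. \<not> p dvd F g"
  shows "maximal_subgroup {y \<in> carrier G. p dvd F y} G"
proof -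
  let ?K = "{y \<in> carrier G. p dvd F y}"
  have F': "p dvd F (y \<otimes> z) \<longleftrightarrow> p dvd F y + F z" if "y \<in> carrier G" "z \<in> carrier G" for y z
    using F[OF that] by (simp add: dvd_eq_mod_eq_0)
  have F1: "p dvd F \<one>"
  proof -
    have "F \<one> mod p = (F \<one> + F \<one>) mod p" using F[of \<one> \<one>] by simp
    then have "p dvd (F \<one> + F \<one>) - F \<one>" by (metis le_add1 mod_eq_dvd_iff_nat)
    then show ?thesis by simp
  qed
  have Fpow: "F (h [^] t) mod p = (t * F h) mod p" if h: "h \<in> carrier G" for h and t :: nat
  proof (induction t)
    case 0
    then show ?case using F1 by simp
  next
    case (Suc t)
    have "F (h [^] Suc t) mod p = (F (h [^] t) + F h) mod p" using F h by simp
    also have "\<dots> = (t * F h + F h) mod p" using Suc by (metis mod_add_left_eq)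
    finally show ?case by (simp add: add.commute)
  qed
  have "subgroup ?K G"
  proof (rule subgroupI)
    show "?K \<noteq> {}" using F1 by blast
  next
    fix y assume y: "y \<in> ?K"
    then have "p dvd F y + F (inv y)" using F'[of y "inv y"] F1 by simp
    then show "inv y \<in> ?K" using y by (simp add: dvd_add_right_iff)
  next
    fix y z assume "y \<in> ?K" "z \<in> ?K"
    then show "y \<otimes> z \<in> ?K" using F'[of y z] by simp
  qed blast
  moreover have "?K \<noteq> carrier G" using nontriv by blast
  moreover have "H = carrier G" if H: "subgroup H G" "?K \<subseteq> H" "H \<noteq> ?K" for H
  proof -
    obtain h where h: "h \<in> H" "\<not> p dvd F h" "h \<in> carrier G"
      using H subgroup.mem_carrier[OF H(1)] by blast
    have "coprime (F h) p" using h(2) prime_p by (metis coprime_commute prime_imp_coprime)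
    moreover have "F h \<noteq> 0" using h(2) by (intro notI) simp
    ultimately obtain j i where ji: "F h * j = p * i + 1"
      using bezout_nat[of "F h" p] by (metis coprime_imp_gcd_eq_1)
    have "y \<in> H" if y: "y \<in> carrier G" for y
    proof -
      \<comment> \<open>With \<open>j\<close> inverse to \<open>F h\<close> modulo \<open>p\<close>
        and \<open>p - 1\<close> standing for -1, this exponent is - F y / F h.\<close>
      let ?t = "j * ((p - 1) * F y)"
      have "F (y \<otimes> h [^] ?t) mod p = (F y + ?t * F h) mod p"
        using F[of y "h [^] ?t"] Fpow[OF h(3), of ?t] y h by (metis mod_add_right_eq nat_pow_closed)
      also have "F y + ?t * F h = p * (F y + i * ((p - 1) * F y))"
      proof -
        have "F y + ?t * F h = F y + (F h * j) * ((p - 1) * F y)" by (simp add: mult_ac)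
        also have "\<dots> = (F y + (p - 1) * F y) + p * i * ((p - 1) * F y)"
          unfolding ji by (simp only: distrib_right mult_1 add_ac)
        also have "F y + (p - 1) * F y = p * F y" using p_ge_2 by (cases p) auto
        finally show ?thesis by (simp add: distrib_left mult_ac)
      qed
      finally have "y \<otimes> h [^] ?t \<in> ?K" using y h by (simp add: dvd_eq_mod_eq_0)
      then have "y \<otimes> h [^] ?t \<in> H" using H(2) by blast
      then show ?thesis
        using subgroup_mult_cancel_right[OF H(1) subgroup_pow_closed[OF H(1) h(1)] y] by blast
    qed
    then show ?thesis using subgroup.subset[OF H(1)] by blast
  qed
  ultimately show ?thesis unfolding maximal_subgroup_def by blast
qed

text \<open>For \<open>x\<close> outside a maximal \<open>M\<close> this is, as a function of
  \<open>y\<close>, the functional with kernel \<open>M\<close> and value -1 at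
  \<open>x\<close>.\<close>

definition shift :: "'a set \<Rightarrow> 'a \<Rightarrow> 'a \<Rightarrow> nat" where
  "shift M x y = (SOME t. t < p \<and> y \<otimes> x [^] t \<in> M)"

lemma shift:
  assumes M: "maximal_subgroup M G" and x: "x \<in> carrier G" "x \<notin> M" and y: "y \<in> carrier G"
  shows shift_less: "shift M x y < p" and shift_mem: "y \<otimes> x [^] shift M x y \<in> M"
    and shift_eqI: "y \<otimes> x [^] t \<in> M \<Longrightarrow> t mod p = shift M x y"
proof -
  have *: "shift M x y < p \<and> y \<otimes> x [^] shift M x y \<in> M"
    unfolding shift_def using shift_into_maximal[OF M x y] by (rule someI_ex)
  then show "shift M x y < p" "y \<otimes> x [^] shift M x y \<in> M" by auto
  assume "y \<otimes> x [^] t \<in> M"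
  then have "y \<otimes> x [^] (t mod p) \<in> M" using x by (simp add: pow_mod)
  then show "t mod p = shift M x y"
    using shift_unique[OF maximal_imp_subgroup[OF M] x y] * p_ge_2 by simp
qed

lemma shift_mult:
  assumes M: "maximal_subgroup M G" and x: "x \<in> carrier G" "x \<notin> M"
    and y: "y \<in> carrier G" and z: "z \<in> carrier G"
  shows "shift M x (y \<otimes> z) = (shift M x y + shift M x z) mod p"
proof (rule shift_eqI[OF M x, symmetric])
  have "(y \<otimes> z) \<otimes> x [^] (shift M x y + shift M x z)
      = (y \<otimes> x [^] shift M x y) \<otimes> (z \<otimes> x [^] shift M x z)"
    using x y z by (simp add: m_ac flip: nat_pow_mult)
  then show "(y \<otimes> z) \<otimes> x [^] (shift M x y + shift M x z) \<in> M"
    using shift_mem[OF M x] y z subgroup.m_closed[OF maximal_imp_subgroup[OF M]] by simp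
qed (use y z in simp)

end

section \<open>Order bounds for ternary covers\<close>

context hyperplane_cover
begin

lemma zeros_bound_common:
  assumes "g \<in> carrier G" "g \<notin> common C"
  shows "card (zeros g) + p \<le> card C"
proof -
  obtain M where "M \<in> C" "g \<notin> M" using assms by (auto simp: common_def)
  then show ?thesis using zeros_bound assms(1) by blast
qed

text \<open>An element of \<open>common S\<close> with three zeros among the other five members has
  \<open>card C - 2\<close> zeros in total, more than an element outside \<open>common C\<close> may
  have.\<close>

lemma card_common_less:
  assumes p: "p = 3" and S: "S \<subseteq> C" "card C = card S + 5"
  shows "card (common S) < 27 * card (common C)"
proof (rule five_maximal_bound[OF p])
  show "subgroup (common S) G" "subgroup (common C) G"
    using S(1) by (auto intro: subgroup_common_sub)
  have finS: "finite S" using S(1) finite_cover by (rule finite_subset)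
  show "card (C - S) = 5" using S finS by (simp add: card_Diff_subset)
  show "maximal_subgroup M G" if "M \<in> C - S" for M using that maximal_member by blast
  show "common C \<subseteq> M" if "M \<in> C - S" for M using that by (auto simp: common_def)
  fix g A B E
  assume g: "g \<in> common S" and ABE: "{A, B, E} \<subseteq> C - S" "A \<noteq> B" "A \<noteq> E" "B \<noteq> E"
    "g \<in> A" "g \<in> B" "g \<in> E"
  have gc: "g \<in> carrier G" and "S \<union> {A, B, E} \<subseteq> zeros g"
    using g ABE S(1) by (auto simp: common_def zeros_def)
  then have "card (S \<union> {A, B, E}) \<le> card (zeros g)" by (intro card_mono finite_zeros)
  moreover have "card (S \<union> {A, B, E}) = card S + card {A, B, E}"
    using ABE(1) finS by (intro card_Un_disjoint) blast+
  moreover have "card {A, B, E} = 3" using ABE(2-4) by simp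
  ultimately show "g \<in> common C" using zeros_bound_common[OF gc] S(2) p by linarith
qed

text \<open>This is the Singleton bound: \<open>card C - 2\<close> zeros already force an element
  into \<open>common C\<close>.\<close>

lemma card_le_common:
  assumes p: "p = 3" and C: "3 \<le> card C"
  shows "card (carrier G) \<le> 3 ^ (card C - 2) * card (common C)"
proof -
  obtain S where S: "S \<subseteq> C" "card S = card C - 2"
    by (meson diff_le_self obtain_subset_with_card_n)
  have "common S \<subseteq> common C"
  proof
    fix g assume g: "g \<in> common S"
    then have gc: "g \<in> carrier G" and "S \<subseteq> zeros g" using S(1) mem_common_iff by auto
    then have "card S \<le> card (zeros g)" by (intro card_mono finite_zeros)
    then show "g \<in> common C" using zeros_bound_common[OF gc] S(2) p C by linarith
  qed
  then have "card (common S) \<le> card (common C)"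
    by (intro card_mono finite_subgroup subgroup_common_sub) auto
  moreover have "card (carrier G) \<le> 3 ^ (card C - 2) * card (common S)"
    using card_common_diff_le[of S "{}"] S finite_cover maximal_member p
    by (simp add: common_empty finite_subset subset_iff)
  ultimately show ?thesis by (meson le_trans mult_le_mono2)
qed

text \<open>The Singleton bound is not attained: equality would leave a [5,3,3] code after imposing
  all but five members.\<close>

lemma card_less_common:
  assumes p: "p = 3" and C: "5 \<le> card C"
  shows "card (carrier G) < 3 ^ (card C - 2) * card (common C)"
proof -
  obtain S where S: "S \<subseteq> C" "card S = card C - 5"
    by (meson diff_le_self obtain_subset_with_card_n)
  have "card (carrier G) \<le> 3 ^ (card C - 5) * card (common S)"
    using card_common_diff_le[of S "{}"] S finite_cover maximal_member p
    by (simp add: common_empty finite_subset subset_iff)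
  also have "\<dots> < 3 ^ (card C - 5) * (27 * card (common C))"
    using card_common_less[OF p S(1)] S(2) C by simp
  also have "\<dots> = 3 ^ (card C - 5 + 3) * card (common C)"
    by (simp only: power_add) simp
  also have "card C - 5 + 3 = card C - 2" using C by simp
  finally show ?thesis .
qed

end

section \<open>Exclusion of order 3^6 and above\<close>

context nine_cover
begin

text \<open>Four members meet in fewer than 27 elements, and in a power of 3, hence in at most 9 =
  3^6 / 3^4. Every cut divides by at most 3, so all cuts on the way to four members divide by
  exactly 3.\<close>

lemma card_common_four:
  assumes p: "p = 3" and N: "card (carrier G) = 3 ^ 6" and S: "S \<subseteq> C" "card S \<le> 4"
  shows "3 ^ card S * card (common S) = 3 ^ 6"
proof -
  have upper: "card (common T) \<le> 9" if T: "T \<subseteq> C" "card T = 4" for T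
  proof -
    have "card (common T) < 27"
      using card_common_less[OF p T(1)] T(2) card_cover common_trivial by simp
    moreover have "card (common T) dvd 3 ^ 6"
      using lagrange[OF subgroup_common_sub[OF T(1)]] N unfolding order_def by (metis dvd_triv_right)
    then obtain k where k: "card (common T) = 3 ^ k"
      using divides_primepow_nat[OF prime_p] unfolding p by blast
    ultimately have "(3::nat) ^ k < 3 ^ 3" by simp
    then have "k < 3" by (rule power_less_imp_less_exp[rotated]) simp
    then have "k \<le> 2" by simp
    then have "(3::nat) ^ k \<le> 3 ^ 2" by (intro power_increasing) auto
    then show ?thesis using k by simp
  qed
  have finS: "finite S" using S(1) finite_cover by (rule finite_subset)
  have "card (C - S) \<ge> 4 - card S" using S finS card_cover by (simp add: card_Diff_subset)
  then obtain U where U: "U \<subseteq> C - S" "card U = 4 - card S" by (meson obtain_subset_with_card_n)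
  have finU: "finite U" using U(1) finite_cover by (meson finite_Diff finite_subset)
  have "S \<inter> U = {}" using U(1) by blast
  then have T: "S \<union> U \<subseteq> C" "card (S \<union> U) = 4" "S \<union> U - S = U"
    using U S finS finU by (auto simp: card_Un_disjoint)
  have mT: "maximal_subgroup M G" if "M \<in> S \<union> U" for M using that T(1) maximal_member by blast
  have "card (common S) \<le> 3 ^ (4 - card S) * card (common (S \<union> U))"
    using card_common_diff_le[of "S \<union> U" S] mT finS finU unfolding T(3) U(2) p by simp
  also have "\<dots> \<le> 3 ^ (4 - card S) * 9" using upper[OF T(1,2)] by simp
  finally have "3 ^ card S * card (common S) \<le> 3 ^ card S * (3 ^ (4 - card S) * 9)" by simp
  also have "\<dots> = 3 ^ (card S + (4 - card S)) * 9" by (simp only: power_add mult.assoc)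
  also have "\<dots> = 3 ^ 6" using S(2) by simp
  finally have "3 ^ card S * card (common S) \<le> 3 ^ 6" .
  moreover have "card (carrier G) \<le> 3 ^ card S * card (common S)"
    using card_common_diff_le[of S "{}"] S(1) finS maximal_member p by (simp add: common_empty subset_iff)
  ultimately show ?thesis using N by simp
qed

text \<open>By the moments the quartic below sums to 2916 over the group, while the identity
  supplies only 1344. Some other element must make it positive, and among the values 1 to 6 only 6
  does.\<close>

lemma exists_six_zeros:
  assumes p: "p = 3" and N: "card (carrier G) = 3 ^ 6"
  shows "\<exists>x\<in>carrier G. card (zeros x) = 6"
proof (rule ccontr)
  assume no: "\<not> ?thesis"
  let ?z = "\<lambda>g. card (zeros g)"
  have m: "3 ^ j * (\<Sum>g\<in>carrier G. ?z g choose j) = (9 choose j) * 3 ^ 6" if "j \<le> 4" for j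
  proof -
    have "p ^ j * card (common S) = card (carrier G)" if "S \<subseteq> C" "card S = j" for S
      using card_common_four[OF p N that(1)] that(2) \<open>j \<le> 4\<close> p N by simp
    from uniform_moment[OF this] show ?thesis by (simp only: p card_cover N)
  qed
  have "9 choose 2 = (36::nat)" "9 choose 3 = (84::nat)" "9 choose 4 = (126::nat)"
    by (simp_all add: eval_nat_numeral)
  with m[of 1] m[of 2] m[of 3] m[of 4]
  have ms: "(\<Sum>g\<in>carrier G. ?z g) = 2187" "(\<Sum>g\<in>carrier G. ?z g choose 2) = 2916"
    "(\<Sum>g\<in>carrier G. ?z g choose 3) = 2268" "(\<Sum>g\<in>carrier G. ?z g choose 4) = 1134"
    by simp_all
  \<comment> \<open>\<open>24 * (z choose 4) - 30 * (z choose 3) + 30 * (z choose 2) - 30 * z + 30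
      = (z - 1) * (z - 2) * (z - 3) * (z - 5)\<close>\<close>
  have "24 * (?z g choose 4) + 30 * (?z g choose 2) + 30
      \<le> 30 * (?z g choose 3) + 30 * ?z g + (if g = \<one> then 1344 else 0)"
    if g: "g \<in> carrier G" for g
  proof (cases "g = \<one>")
    case True
    then show ?thesis by (simp add: zeros_one_card) (simp add: eval_nat_numeral)
  next
    case False
    moreover have "?z g \<noteq> 6" using no g by blast
    ultimately have "?z g = 1 \<or> ?z g = 2 \<or> ?z g = 3 \<or> ?z g = 4 \<or> ?z g = 5"
      using zeros_le[OF g] zeros_pos[OF g] p by linarith
    then show ?thesis by (auto simp: eval_nat_numeral)
  qed
  then have "(\<Sum>g\<in>carrier G. 24 * (?z g choose 4) + 30 * (?z g choose 2) + 30)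
      \<le> (\<Sum>g\<in>carrier G. 30 * (?z g choose 3) + 30 * ?z g + (if g = \<one> then 1344 else 0))"
    by (rule sum_mono)
  also have "(\<Sum>g\<in>carrier G. 30 * (?z g choose 3) + 30 * ?z g + (if g = \<one> then 1344 else 0))
      = 30 * 2268 + 30 * 2187 + 1344"
    by (simp only: sum.distrib sum_one sum_distrib_left[symmetric] ms)
  also have "(\<Sum>g\<in>carrier G. 24 * (?z g choose 4) + 30 * (?z g choose 2) + 30)
      = 24 * 1134 + 30 * 2916 + 30 * 3 ^ 6"
    by (simp only: sum.distrib sum_distrib_left[symmetric] ms sum_constant N) simp
  finally show False by simp
qed

text \<open>Let \<open>x\<close> have six zeros and let \<open>F\<close> add the functionals of the
  three other members, all normalised at \<open>x\<close>. If \<open>y\<close> avoids the six, its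
  three shifts along \<open>x\<close> lie one in each of the three members, so the summands of
  \<open>F y\<close> are 0, 1, 2 and their sum vanishes modulo 3. Hence the kernel \<open>L\<close>
  of \<open>F\<close> completes the six to a cover. In an irredundant subcover the members
  \<open>Y\<close> other than \<open>L\<close> meet in a subgroup too small for the order
  bounds.\<close>

lemma card_carrier_neq_729:
  assumes p: "p = 3"
  shows "card (carrier G) \<noteq> 3 ^ 6"
proof
  assume N: "card (carrier G) = 3 ^ 6"
  have cN: "card (common S) * 3 ^ card S = 729" if "S \<subseteq> C" "card S \<le> 4" for S
    using card_common_four[OF p N that] by (simp add: mult.commute)
  obtain x where x: "x \<in> carrier G" "card (zeros x) = 6"
    using exists_six_zeros[OF p N] by blast
  let ?Z = "zeros x" and ?J = "C - zeros x"
  have J: "card ?J = 3" "finite ?J"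
    using x card_cover finite_cover by (simp_all add: card_Diff_subset finite_zeros zeros_subset)
  have mJ: "maximal_subgroup M G" "x \<notin> M" if "M \<in> ?J" for M
    using that maximal_member by (auto simp: zeros_def)
  define F where "F y = (\<Sum>M\<in>?J. shift M x y)" for y
  define L where "L = {y \<in> carrier G. p dvd F y}"
  obtain Ma Mb Mc where abc: "?J = {Ma, Mb, Mc}" "Ma \<noteq> Mb" "Ma \<noteq> Mc" "Mb \<noteq> Mc"
    using J(1) unfolding card_3_iff by blast
  have abcJ: "Ma \<in> ?J" "Mb \<in> ?J" "Mc \<in> ?J" unfolding abc(1) by simp_all
  have "maximal_subgroup L G"
    unfolding L_def
  proof (rule kernel_maximal)
    fix y z assume yz: "y \<in> carrier G" "z \<in> carrier G"
    have "F (y \<otimes> z) mod p = (\<Sum>M\<in>?J. (shift M x y + shift M x z) mod p) mod p"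
      using shift_mult[OF mJ(1) x(1) mJ(2) yz] by (simp add: F_def)
    also have "\<dots> = (F y + F z) mod p"
      by (simp only: mod_sum_eq F_def sum.distrib)
    finally show "F (y \<otimes> z) mod p = (F y + F z) mod p" .
  next
    \<comment> \<open>Independence of the three members yields a \<open>g\<close> at which only the
      third summand of \<open>F\<close> survives, so \<open>F\<close> is not zero.\<close>
    have "\<not> Ma \<inter> Mb \<subseteq> Mc"
    proof
      assume "Ma \<inter> Mb \<subseteq> Mc"
      then have "common {Ma, Mb} = common {Ma, Mb, Mc}" by (auto simp: common_def)
      moreover have "card (common {Ma, Mb}) * 9 = 729" "card (common {Ma, Mb, Mc}) * 27 = 729"
        using cN[of "{Ma, Mb}"] cN[of "{Ma, Mb, Mc}"] abc(2-4) abcJ by simp_all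
      ultimately show False by simp
    qed
    then obtain g where g: "g \<in> Ma" "g \<in> Mb" "g \<notin> Mc" by blast
    have gc: "g \<in> carrier G"
      using subgroup.mem_carrier[OF maximal_imp_subgroup[OF mJ(1)[OF abcJ(1)]] g(1)] .
    have "shift M x g = 0" if "M \<in> ?J" "g \<in> M" for M
      using shift_eqI[OF mJ(1)[OF that(1)] x(1) mJ(2)[OF that(1)] gc, of 0] that(2) gc by simp
    then have "shift Ma x g = 0" "shift Mb x g = 0" using abcJ g by blast+
    moreover have "shift Mc x g \<noteq> 0"
      using shift_mem[OF mJ(1)[OF abcJ(3)] x(1) mJ(2)[OF abcJ(3)] gc] g(3) gc by (intro notI) simp
    moreover have "shift Mc x g < p"
      using shift_less[OF mJ(1)[OF abcJ(3)] x(1) mJ(2)[OF abcJ(3)] gc] .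
    moreover have "F g = shift Ma x g + (shift Mb x g + shift Mc x g)"
      unfolding F_def abc(1) using abc(2-4) by simp
    ultimately have "\<not> p dvd F g" by (auto dest: dvd_imp_le)
    then show "\<exists>g\<in>carrier G. \<not> p dvd F g" using gc by blast
  qed
  note mL = this
  have L: "y \<in> L" if y: "y \<in> carrier G" "\<And>K. K \<in> ?Z \<Longrightarrow> y \<notin> K" for y
  proof -
    obtain f where f: "inj_on f {..<p}" "\<And>t. t < p \<Longrightarrow> f t \<in> ?J"
      "\<And>t. t < p \<Longrightarrow> y \<otimes> x [^] (t::nat) \<in> f t"
      using shifts_avoid_zeros[OF x(1) y] by metis
    have "f ` {..<p} = ?J"
      using f J p by (intro card_subset_eq) (auto simp: card_image)
    then have "F y = (\<Sum>t<p. shift (f t) x y)"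
      unfolding F_def using sum.reindex[OF f(1), of "\<lambda>M. shift M x y"] by simp
    also have "\<dots> = (\<Sum>t<p. t)"
    proof (rule sum.cong[OF refl])
      fix t assume "t \<in> {..<p}"
      then have t: "t < p" by simp
      show "shift (f t) x y = t"
        using shift_eqI[OF mJ(1)[OF f(2)[OF t]] x(1) mJ(2)[OF f(2)[OF t]] y(1) f(3)[OF t]] t by simp
    qed
    also have "\<dots> = 3" by (simp add: p numeral_3_eq_3)
    finally show ?thesis using y(1) p by (simp add: L_def)
  qed
  let ?h = "priv Ma"
  have aC: "Ma \<in> C" "Ma \<notin> ?Z" using abcJ by blast+
  have h: "?h \<in> carrier G" "?h \<notin> K" if "K \<in> ?Z" for K
    using that aC priv_carrier priv_mem_iff[OF aC(1), of K] zeros_subset by blast+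
  have "?Z \<noteq> {}" using x(2) by (intro notI) simp
  \<comment> \<open>A private element of \<open>Ma\<close> avoids all six members and so falls into
    \<open>L\<close>. It shows that \<open>L\<close> is not one of them, and serves as private
    element of \<open>L\<close> in the subcover.\<close>
  then have hL: "?h \<in> L" using L h by blast
  then have LZ: "L \<notin> ?Z" using h by blast
  \<comment> \<open>A \<open>Y\<close> of least size makes each of its members
    indispensable.\<close>
  let ?U = "{Y. Y \<subseteq> ?Z \<and> carrier G \<subseteq> L \<union> \<Union>Y}"
  have "?Z \<in> ?U" using L by blast
  then have "\<exists>Y. Y \<in> ?U \<and> (\<forall>V. V \<in> ?U \<longrightarrow> card Y \<le> card V)" by (rule ex_has_least_nat)
  then obtain Y where Y: "Y \<in> ?U" and minY: "\<forall>V. V \<in> ?U \<longrightarrow> card Y \<le> card V"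
    by (elim exE conjE)
  have YZ: "Y \<subseteq> ?Z" "Y \<subseteq> C" and coverY: "carrier G \<subseteq> L \<union> \<Union>Y" using Y zeros_subset by auto
  have finY: "finite Y" using YZ(1) finite_zeros by (rule finite_subset)
  have LY: "L \<notin> Y" using LZ YZ by blast
  interpret sub: hyperplane_cover G p "insert L Y"
  proof unfold_locales
    show "finite (insert L Y)" using finY by simp
    show "maximal_subgroup M G" if "M \<in> insert L Y" for M using that mL YZ maximal_member by blast
    show "\<exists>M\<in>insert L Y. g \<in> M" if "g \<in> carrier G" for g using that coverY by blast
    fix M assume M: "M \<in> insert L Y"
    show "\<exists>c\<in>carrier G. \<forall>N\<in>insert L Y - {M}. c \<notin> N"
    proof (cases "M = L")
      case True
      then show ?thesis using h YZ \<open>?Z \<noteq> {}\<close> by blast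
    next
      case False
      then have MY: "M \<in> Y" using M by blast
      then have "card (Y - {M}) < card Y" using finY by (intro card_Diff1_less)
      then have "Y - {M} \<notin> ?U" using minY by (meson not_le)
      then have "\<not> carrier G \<subseteq> L \<union> \<Union>(Y - {M})" using YZ by blast
      then show ?thesis by blast
    qed
  qed
  have cardY: "card (insert L Y) = Suc (card Y)" using LY finY by simp
  have Y6: "card Y \<le> 6" using card_mono[OF finite_zeros YZ(1)] x(2) by simp
  have Y2: "2 \<le> card Y" using sub.p_le_card p cardY by simp
  have DY: "card (common (insert L Y)) \<le> card (common Y)"
    using YZ(2) by (intro card_mono finite_subgroup subgroup_common_sub common_antimono) auto
  have weak: "729 \<le> 3 ^ (card Y - 1) * card (common Y)"
  proof -
    have "card (carrier G) \<le> 3 ^ (card Y - 1) * card (common (insert L Y))"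
      using sub.card_le_common[OF p] cardY Y2 by simp
    also have "\<dots> \<le> 3 ^ (card Y - 1) * card (common Y)" using DY by simp
    finally show ?thesis using N by simp
  qed
  have strong: "729 < 3 ^ (card Y - 1) * card (common Y)" if "4 \<le> card Y"
  proof -
    have "card (carrier G) < 3 ^ (card Y - 1) * card (common (insert L Y))"
      using sub.card_less_common[OF p] cardY that by simp
    also have "\<dots> \<le> 3 ^ (card Y - 1) * card (common Y)" using DY by simp
    finally show ?thesis using N by simp
  qed
  \<comment> \<open>With this bound \<open>3 ^ (card Y - 1) * card (common Y)\<close> is at most 243
    for four members and 729 for five, where the strictness of \<open>strong\<close>
    decides.\<close>
  have small: "card (common Y) \<le> 9" if Y4: "4 \<le> card Y"
  proof -
    obtain T where T: "T \<subseteq> Y" "card T = 4" using Y4 by (meson obtain_subset_with_card_n)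
    have TC: "T \<subseteq> C" using T(1) YZ(2) by blast
    have "card (common Y) \<le> card (common T)"
      using T(1) by (intro card_mono finite_subgroup subgroup_common_sub[OF TC] common_antimono)
    then show ?thesis using cN[OF TC] T(2) by simp
  qed
  consider "card Y = 2" | "card Y = 3" | "card Y = 4" | "card Y = 5" | "card Y = 6"
    using Y2 Y6 by linarith
  then show False
  proof cases
    \<comment> \<open>This is the alternative \<open>card Y = 6\<close>. A seventh zero is left only
      to the identity, so \<open>common Y\<close> has at most 3 elements, and
      \<open>3 ^ 5 * 3 = 729\<close> contradicts \<open>strong\<close>.\<close>
    case 5
    have "Y = ?Z" using YZ(1) 5 x(2) finite_zeros by (metis card_subset_eq)
    have "common Y \<inter> Ma \<subseteq> {\<one>}"
    proof
      fix g assume g: "g \<in> common Y \<inter> Ma"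
      then have gc: "g \<in> carrier G" and "insert Ma ?Z \<subseteq> zeros g"
        using aC zeros_subset \<open>Y = ?Z\<close> by (auto simp: common_def zeros_def)
      then have "card (insert Ma ?Z) \<le> card (zeros g)" by (intro card_mono finite_zeros)
      then have "7 \<le> card (zeros g)" using aC(2) x(2) finite_zeros by simp
      then show "g \<in> {\<one>}" using zeros_le[OF gc] p by force
    qed
    then have "card (common Y \<inter> Ma) \<le> card {\<one>}" by (intro card_mono) auto
    moreover have "card (common Y) \<le> p * card (common Y \<inter> Ma)"
      using aC(1) YZ(2) by (intro card_Int_maximal_le subgroup_common_sub maximal_member)
    ultimately have "card (common Y) \<le> 3" using p by simp
    then show False using strong 5 by simp
  next
    case 1
    then show False using weak cN[OF YZ(2)] by simp
  next
    case 2
    then show False using weak cN[OF YZ(2)] by simp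
  qed (use strong small in simp_all)
qed

lemma order_3_le:
  assumes p: "p = 3" and N: "card (carrier G) = 3 ^ e"
  shows "e \<le> 5"
proof (rule ccontr)
  assume "\<not> e \<le> 5"
  moreover have "(3::nat) ^ e < 3 ^ 7"
    using card_less_common[OF p] N by (simp add: card_cover common_trivial)
  then have "e < 7" by (rule power_less_imp_less_exp[rotated]) simp
  ultimately have "e = 6" by simp
  then show False using card_carrier_neq_729[OF p] N by simp
qed

end

section \<open>Finiteness and maximal subgroups of p-groups\<close>

text \<open>Induction on \<open>U\<close>: the intersection \<open>?N\<close> of the members outside
  \<open>U\<close> lies in finitely many cosets of the full intersection. Translate
  \<open>?N\<close> by an element \<open>c\<close> private to some \<open>M\<close> in
  \<open>U\<close>. Each \<open>g * c\<close> lies in a member \<open>K\<close> of \<open>U\<close>,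
  and those \<open>g\<close> belonging to one \<open>K\<close> form a single coset of the
  intersection of \<open>?N\<close> and \<open>K\<close>, to which the hypothesis for
  \<open>U - {K}\<close> applies.\<close>

lemma (in group) finite_coset_cover:
  assumes fin: "finite C" and sub: "\<And>M. M \<in> C \<Longrightarrow> subgroup M G"
    and cover: "\<And>g. g \<in> carrier G \<Longrightarrow> \<exists>M\<in>C. g \<in> M"
    and private_ex: "\<And>M. M \<in> C \<Longrightarrow> \<exists>c\<in>carrier G. \<forall>N\<in>C - {M}. c \<notin> N"
  shows "\<exists>T. finite T \<and> T \<subseteq> carrier G \<and> (\<forall>g\<in>carrier G. \<exists>t\<in>T. g \<otimes> inv t \<in> \<Inter>C)"
proof -
  have "\<exists>T. finite T \<and> T \<subseteq> carrier G \<and> (\<forall>g\<in>carrier G \<inter> \<Inter>(C - U). \<exists>t\<in>T. g \<otimes> inv t \<in> \<Inter>C)"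
    if "finite U" "U \<subseteq> C" for U
    using that
  proof (induction "card U" arbitrary: U)
    case 0
    then have "U = {}" by simp
    then show ?case by (intro exI[of _ "{\<one>}"]) auto
  next
    case (Suc n)
    then obtain M where M: "M \<in> U" by fastforce
    then obtain c where c: "c \<in> carrier G" "\<And>N. N \<in> C \<Longrightarrow> N \<noteq> M \<Longrightarrow> c \<notin> N"
      using private_ex Suc.prems by (metis DiffI singletonD subsetD)
    let ?N = "carrier G \<inter> \<Inter>(C - U)"
    have "\<exists>T. finite T \<and> T \<subseteq> carrier G \<and> (\<forall>g\<in>?N. g \<otimes> c \<in> K \<longrightarrow> (\<exists>t\<in>T. g \<otimes> inv t \<in> \<Inter>C))"
      if K: "K \<in> U" for K
    proof (cases "\<exists>b\<in>?N. b \<otimes> c \<in> K")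
      case True
      then obtain b where b: "b \<in> ?N" "b \<otimes> c \<in> K" by blast
      have "n = card (U - {K})" "finite (U - {K})" "U - {K} \<subseteq> C"
        using K Suc by auto
      from Suc.hyps(1)[OF this] obtain T where T: "finite T" "T \<subseteq> carrier G"
        "\<forall>g\<in>carrier G \<inter> \<Inter>(C - (U - {K})). \<exists>t\<in>T. g \<otimes> inv t \<in> \<Inter>C" by blast
      have "\<exists>t\<in>(\<lambda>t. t \<otimes> b) ` T. g \<otimes> inv t \<in> \<Inter>C" if g: "g \<in> ?N" "g \<otimes> c \<in> K" for g
      proof -
        have gb: "g \<in> carrier G" "b \<in> carrier G" using g b by auto
        have "g \<otimes> inv b \<in> L" if L: "L \<in> C - (U - {K})" for L
        proof (cases "L = K")
          case True
          have sK: "subgroup K G" using K Suc.prems sub by blast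
          have "(g \<otimes> c) \<otimes> inv (b \<otimes> c) \<in> K"
            using subgroup.m_closed[OF sK g(2) subgroup.m_inv_closed[OF sK b(2)]] .
          moreover have "(g \<otimes> c) \<otimes> inv (b \<otimes> c) = g \<otimes> inv b"
          proof -
            have "c \<otimes> (inv c \<otimes> inv b) = inv b" using gb c(1) by (simp add: m_assoc[symmetric])
            then show ?thesis using gb c(1) by (simp add: inv_mult_group m_assoc)
          qed
          ultimately show ?thesis using True by simp
        next
          case False
          then have LU: "L \<in> C - U" using L by blast
          then have sL: "subgroup L G" using sub by blast
          have "g \<in> L" "b \<in> L" using g(1) b(1) LU by blast+
          then show ?thesis using subgroup.m_closed[OF sL] subgroup.m_inv_closed[OF sL] by blast
        qed
        then have "g \<otimes> inv b \<in> carrier G \<inter> \<Inter>(C - (U - {K}))" using gb by simp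
        then obtain t where t: "t \<in> T" "(g \<otimes> inv b) \<otimes> inv t \<in> \<Inter>C" using T(3) by blast
        moreover have "(g \<otimes> inv b) \<otimes> inv t = g \<otimes> inv (t \<otimes> b)"
          using gb t(1) T(2) by (simp add: inv_mult_group m_assoc subset_iff)
        ultimately show ?thesis by auto
      qed
      moreover have "(\<lambda>t. t \<otimes> b) ` T \<subseteq> carrier G" using T(2) b(1) by auto
      ultimately show ?thesis using T(1) by (intro exI[of _ "(\<lambda>t. t \<otimes> b) ` T"]) simp
    qed (intro exI[of _ "{}"], simp)
    then obtain T where T: "\<And>K. K \<in> U \<Longrightarrow> finite (T K)" "\<And>K. K \<in> U \<Longrightarrow> T K \<subseteq> carrier G"
      "\<And>K g. K \<in> U \<Longrightarrow> g \<in> ?N \<Longrightarrow> g \<otimes> c \<in> K \<Longrightarrow> \<exists>t\<in>T K. g \<otimes> inv t \<in> \<Inter>C"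
      by metis
    have "\<exists>t\<in>\<Union>(T ` U). g \<otimes> inv t \<in> \<Inter>C" if g: "g \<in> ?N" for g
    proof -
      have gc: "g \<in> carrier G" using g by simp
      then obtain K where K: "K \<in> C" "g \<otimes> c \<in> K" using cover c(1) by blast
      \<comment> \<open>Otherwise \<open>K\<close> contains \<open>g\<close> as well as
        \<open>g * c\<close>, hence \<open>c\<close>, which is private to \<open>M\<close>.\<close>
      have "K \<in> U"
      proof (rule ccontr)
        assume "K \<notin> U"
        then have "g \<in> K" "K \<noteq> M" using g K(1) M by auto
        have sK: "subgroup K G" using K(1) sub by blast
        have "inv g \<otimes> (g \<otimes> c) \<in> K"
          using subgroup.m_closed[OF sK subgroup.m_inv_closed[OF sK \<open>g \<in> K\<close>] K(2)] .
        moreover have "inv g \<otimes> (g \<otimes> c) = c" using gc c(1) by (simp add: m_assoc[symmetric])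
        ultimately show False using c(2)[OF K(1) \<open>K \<noteq> M\<close>] by simp
      qed
      then show ?thesis using T(3)[OF _ g K(2)] by blast
    qed
    moreover have "finite (\<Union>(T ` U))" using T(1) Suc.prems(1) by blast
    moreover have "\<Union>(T ` U) \<subseteq> carrier G" using T(2) by blast
    ultimately show ?case by blast
  qed
  from this[OF fin] show ?thesis by simp
qed

lemma (in group) mem_normal_core:
  assumes "u \<in> carrier G" "\<And>g. g \<in> carrier G \<Longrightarrow> g \<otimes> u \<otimes> inv g \<in> D"
  shows "u \<in> normal_core G D"
  unfolding normal_core_def
proof
  fix g assume g: "g \<in> carrier G"
  have "u = inv g \<otimes> (g \<otimes> u \<otimes> inv g) \<otimes> g"
  proof -
    have "inv g \<otimes> (g \<otimes> (u \<otimes> inv g)) = u \<otimes> inv g"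
      using assms(1) g by (simp add: m_assoc[symmetric])
    then show ?thesis using assms(1) g by (simp add: m_assoc)
  qed
  then show "u \<in> (inv g <# D) #> g"
    using assms(2)[OF g] unfolding r_coset_def l_coset_def by blast
qed

text \<open>The core is the kernel of right multiplication on the finitely many cosets of
  \<open>D\<close>. The map \<open>?f\<close> records this action on representatives; it is
  set-valued since several elements of \<open>T\<close> may represent one coset.\<close>

lemma (in group) finite_if_core_free:
  assumes D: "subgroup D G" and core: "normal_core G D = {\<one>}"
    and T: "finite T" "T \<subseteq> carrier G" "\<And>g. g \<in> carrier G \<Longrightarrow> \<exists>t\<in>T. g \<otimes> inv t \<in> D"
  shows "finite (carrier G)"
proof -
  let ?f = "\<lambda>g. \<lambda>t\<in>T. {s \<in> T. t \<otimes> g \<otimes> inv s \<in> D}"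
  have "inj_on ?f (carrier G)"
  proof (rule inj_onI)
    fix g h assume gh: "g \<in> carrier G" "h \<in> carrier G" "?f g = ?f h"
    have Tc: "t \<in> carrier G" if "t \<in> T" for t using that T(2) by blast
    have conj: "t \<otimes> (g \<otimes> inv h) \<otimes> inv t \<in> D" if t: "t \<in> T" for t
    proof -
      obtain s where s: "s \<in> T" "t \<otimes> g \<otimes> inv s \<in> D" using T(3)[of "t \<otimes> g"] gh Tc[OF t] by auto
      have "?f g t = ?f h t" using gh(3) by simp
      then have "t \<otimes> h \<otimes> inv s \<in> D" using s t by auto
      then have "(t \<otimes> g \<otimes> inv s) \<otimes> inv (t \<otimes> h \<otimes> inv s) \<in> D"
        using s(2) subgroup.m_closed[OF D] subgroup.m_inv_closed[OF D] by blast
      also have "(t \<otimes> g \<otimes> inv s) \<otimes> inv (t \<otimes> h \<otimes> inv s) = t \<otimes> (g \<otimes> inv h) \<otimes> inv t"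
      proof -
        have "inv s \<otimes> (s \<otimes> (inv h \<otimes> inv t)) = inv h \<otimes> inv t"
          using Tc[OF s(1)] Tc[OF t] gh by (simp add: m_assoc[symmetric])
        then show ?thesis using Tc[OF s(1)] Tc[OF t] gh by (simp add: inv_mult_group m_assoc)
      qed
      finally show ?thesis .
    qed
    have u: "g \<otimes> inv h \<in> carrier G" using gh by simp
    have "g \<otimes> inv h \<in> normal_core G D"
    proof (rule mem_normal_core[OF u])
      \<comment> \<open>Write \<open>a\<close> as an element of \<open>D\<close> times a
        representative, for which the conjugate is already known to lie in \<open>D\<close>.\<close>
      fix a assume a: "a \<in> carrier G"
      obtain t where t: "t \<in> T" "a \<otimes> inv t \<in> D" using T(3)[OF a] by blast
      let ?d = "a \<otimes> inv t" and ?u = "g \<otimes> inv h"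
      have "?d \<otimes> (t \<otimes> ?u \<otimes> inv t) \<otimes> inv ?d \<in> D"
        using t conj[OF t(1)] subgroup.m_closed[OF D] subgroup.m_inv_closed[OF D] by blast
      also have "?d \<otimes> (t \<otimes> ?u \<otimes> inv t) \<otimes> inv ?d = a \<otimes> ?u \<otimes> inv a"
      proof -
        have "inv t \<otimes> (t \<otimes> (?u \<otimes> inv a)) = ?u \<otimes> inv a" "inv t \<otimes> (t \<otimes> inv a) = inv a"
          using u a Tc[OF t(1)] by (simp_all add: m_assoc[symmetric] del: inv_mult_group)
        then show ?thesis using u a Tc[OF t(1)] gh by (simp add: inv_mult_group m_assoc)
      qed
      finally show "a \<otimes> ?u \<otimes> inv a \<in> D" .
    qed
    then have "g \<otimes> inv h = \<one>" using core by simp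
    then show "g = h" using gh by (metis inv_closed inv_equality inv_inv)
  qed
  moreover have "?f ` carrier G \<subseteq> (\<Pi>\<^sub>E t\<in>T. Pow T)" by auto
  moreover have "finite (\<Pi>\<^sub>E t\<in>T. Pow T)" using T(1) by (intro finite_PiE) auto
  ultimately show ?thesis by (meson finite_subset finite_imageD)
qed

section \<open>Orders, fixed points and maximal subgroups of finite p-groups\<close>

text \<open>Sylow's theorem with exponent 1 serves as Cauchy's theorem: a prime divisor
  \<open>q\<close> of the order is the order of an element, hence a power of
  \<open>p\<close>.\<close>

lemma (in group) order_p_group:
  assumes fin: "finite (carrier G)" and p: "Factorial_Ring.prime p"
    and ord: "\<And>x. x \<in> carrier G \<Longrightarrow> \<exists>k. ord x = p ^ k"
  shows "\<exists>n. order G = p ^ n"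
proof -
  have "q = p" if q: "Factorial_Ring.prime q" "q dvd order G" for q
  proof -
    obtain m where "order G = q ^ 1 * m" using q(2) by auto
    then obtain H where H: "subgroup H G" "card H = q ^ 1"
      using sylow_thm[OF q(1) is_group _ fin, of 1 m] by auto
    have "H \<noteq> {\<one>}" using H(2) q(1) by (auto simp: prime_nat_iff)
    then obtain x where x: "x \<in> H" "x \<noteq> \<one>" using subgroup.one_closed[OF H(1)] by blast
    have xc: "x \<in> carrier G" using subgroup.mem_carrier[OF H(1) x(1)] .
    interpret H: group "G\<lparr>carrier := H\<rparr>" using subgroup.subgroup_is_group[OF H(1) is_group] .
    have "x [^]\<^bsub>G\<lparr>carrier := H\<rparr>\<^esub> order (G\<lparr>carrier := H\<rparr>) = \<one>"
      using H.pow_order_eq_1[of x] x(1) by simp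
    then have "x [^] q = \<one>" using H(2) by (simp add: order_def nat_pow_consistent[symmetric])
    then have "ord x dvd q" using xc pow_eq_id by simp
    then have "ord x = q" using q(1) xc x(2) ord_eq_1 by (auto simp: prime_nat_iff)
    then obtain k where "q = p ^ k" using ord[OF xc] by auto
    then have "q dvd p" using q(1) by (metis dvd_refl prime_dvd_power)
    then show ?thesis using q(1) p by (simp add: primes_dvd_imp_eq)
  qed
  moreover have "order G \<noteq> 0" using fin order_gt_0_iff_finite by simp
  then obtain m where m: "order G = p ^ multiplicity p (order G) * m" "\<not> p dvd m"
    using multiplicity_decompose'[of "order G" p] p by (metis not_prime_unit)
  ultimately have "m = 1" by (metis dvd_mult prime_factor_nat)
  then have "order G = p ^ multiplicity p (order G)" using m(1) by simp
  then show ?thesis by blast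
qed

text \<open>Orbits with more than one point have length divisible by \<open>p\<close>, so a single
  fixed point would make \<open>card E\<close> congruent to 1.\<close>

lemma (in group_action) exists_other_fixed_point:
  assumes p: "Factorial_Ring.prime p" and G: "order G = p ^ n" and E: "finite E" "p dvd card E"
    and x0: "x0 \<in> E" "\<And>g. g \<in> carrier G \<Longrightarrow> \<phi> g x0 = x0"
  shows "\<exists>x\<in>E. x \<noteq> x0 \<and> (\<forall>g\<in>carrier G. \<phi> g x = x)"
proof (rule ccontr)
  assume no: "\<not> ?thesis"
  interpret group_hom G "BijGroup E" \<phi> by (rule group_hom)
  let ?O = "orbits G E \<phi>"
  have o0: "{x0} \<in> ?O"
  proof -
    have "x0 \<in> orbit G \<phi> x0" using orbit_refl[OF x0(1)] .
    moreover have "orbit G \<phi> x0 \<subseteq> {x0}" using x0(2) by (auto simp: orbit_def)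
    ultimately have "orbit G \<phi> x0 = {x0}" by blast
    then show ?thesis using x0(1) by (auto simp: orbits_def)
  qed
  have finO: "finite ?O" using E(1) orbits_coverture by (metis finite_UnionD)
  have "p dvd card B" if B: "B \<in> ?O - {{x0}}" for B
  proof -
    obtain x where x: "x \<in> E" "B = orbit G \<phi> x" using B by (auto simp: orbits_def)
    have "card B dvd p ^ n"
      using orbit_stabilizer_theorem[OF x(1)] G x(2) by (metis dvd_triv_left)
    then obtain k where k: "card B = p ^ k" using divides_primepow_nat[OF p] by blast
    have "k \<noteq> 0"
    proof
      assume "k = 0"
      then have "card B = 1" using k by simp
      then obtain y where "B = {y}" by (rule card_1_singletonE)
      moreover have "x \<in> B" using orbit_refl[OF x(1)] x(2) by simp
      ultimately have Bx: "B = {x}" by simp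
      then have "x \<noteq> x0" using B by blast
      moreover have "\<phi> g x = x" if "g \<in> carrier G" for g
      proof -
        have "\<phi> g x \<in> B" unfolding x(2) orbit_def using that by blast
        then show ?thesis using Bx by simp
      qed
      ultimately show False using no x(1) by blast
    qed
    then show ?thesis using k by simp
  qed
  then have "p dvd (\<Sum>B\<in>?O - {{x0}}. card B)" by (rule dvd_sum)
  moreover have "card E = (\<Sum>B\<in>?O. card B)"
    using disjoint_sum[OF E(1), of "\<lambda>_. 1::nat"] by simp
  moreover have "(\<Sum>B\<in>?O. card B) = 1 + (\<Sum>B\<in>?O - {{x0}}. card B)"
    using sum.remove[OF finO o0, of card] by simp
  ultimately have "p dvd 1" using E(2) by (metis dvd_add_left_iff)
  then show False using p by simp
qed

text \<open>The inverse turns right multiplication into a left action, and the restricted lambda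
  meets the extensionality demanded by \<open>Bij\<close>.\<close>

lemma (in group) rcosets_right_action:
  assumes M: "subgroup M G"
  shows "group_action (G\<lparr>carrier := M\<rparr>) (rcosets M) (\<lambda>m. \<lambda>K\<in>rcosets M. K #> inv m)"
proof -
  let ?H = "G\<lparr>carrier := M\<rparr>" and ?E = "rcosets M"
  let ?f = "\<lambda>m. \<lambda>K\<in>?E. K #> inv m"
  have Mc: "m \<in> carrier G" if "m \<in> M" for m using subgroup.mem_carrier[OF M that] .
  have Ksub: "K \<subseteq> carrier G" if "K \<in> ?E" for K
    using that subgroup.rcosets_carrier[OF M is_group] by blast
  have closed: "K #> g \<in> ?E" if K: "K \<in> ?E" and g: "g \<in> carrier G" for K g
  proof -
    obtain a where a: "a \<in> carrier G" "K = M #> a" using K by (auto simp: RCOSETS_def)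
    then have "K #> g = M #> (a \<otimes> g)"
      using coset_mult_assoc[OF subgroup.subset[OF M] a(1) g] by simp
    then show ?thesis using a(1) g by (auto simp: RCOSETS_def)
  qed
  have bij: "?f m \<in> Bij ?E" if m: "m \<in> M" for m
  proof -
    have "bij_betw (?f m) ?E ?E"
    proof (rule bij_betwI[where g = "\<lambda>K. K #> m"])
      show "?f m \<in> ?E \<rightarrow> ?E" using closed Mc[OF m] by auto
      show "(\<lambda>K. K #> m) \<in> ?E \<rightarrow> ?E" using closed Mc[OF m] by auto
    qed (use closed Mc[OF m] Ksub in \<open>simp_all add: coset_mult_assoc\<close>)
    then show ?thesis by (simp add: Bij_def)
  qed
  have "?f \<in> hom ?H (BijGroup ?E)"
  proof (rule homI)
    show "?f m \<in> carrier (BijGroup ?E)" if "m \<in> carrier ?H" for m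
      using that bij by (simp add: BijGroup_def)
    fix m n assume "m \<in> carrier ?H" "n \<in> carrier ?H"
    then have mn: "m \<in> M" "n \<in> M" by auto
    have "?f (m \<otimes> n) = compose ?E (?f m) (?f n)"
    proof
      fix K
      show "?f (m \<otimes> n) K = compose ?E (?f m) (?f n) K"
      proof (cases "K \<in> ?E")
        case True
        have "K #> inv n \<in> ?E" using closed[OF True] Mc[OF mn(2)] by simp
        then show ?thesis
          using True Mc[OF mn(1)] Mc[OF mn(2)] Ksub[OF True]
          by (simp add: compose_def inv_mult_group coset_mult_assoc)
      qed (simp add: compose_def)
    qed
    then show "?f (m \<otimes>\<^bsub>?H\<^esub> n) = ?f m \<otimes>\<^bsub>BijGroup ?E\<^esub> ?f n"
      using bij mn by (simp add: BijGroup_def)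
  qed
  then show ?thesis
    unfolding group_action_def group_hom_def group_hom_axioms_def
    using subgroup.subgroup_is_group[OF M is_group] group_BijGroup by blast
qed

text \<open>Normalizers grow: \<open>M\<close> acts on its cosets and fixes \<open>M\<close> itself;
  a second fixed coset \<open>M #> x\<close> yields an \<open>x\<close> outside \<open>M\<close>
  that normalizes \<open>M\<close>, so by maximality the normalizer is everything.\<close>

lemma (in group) maximal_subgroup_normal:
  assumes p: "Factorial_Ring.prime p" and G: "order G = p ^ n" and M: "maximal_subgroup M G"
  shows "M \<lhd> G"
proof -
  have sM: "subgroup M G" using M by (simp add: maximal_subgroup_def)
  have fin: "finite (carrier G)"
    using G p order_gt_0_iff_finite by (metis prime_gt_0_nat zero_less_power)
  have Mc: "m \<in> carrier G" if "m \<in> M" for m using subgroup.mem_carrier[OF sM that] .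
  have finM: "finite M" using fin subgroup.subset[OF sM] by (rule rev_finite_subset)
  have lag: "card (rcosets M) * card M = p ^ n" using lagrange[OF sM] G by simp
  obtain a where a: "card M = p ^ a" using lag divides_primepow_nat[OF p] by (metis dvd_triv_right)
  obtain b where b: "card (rcosets M) = p ^ b" using lag divides_primepow_nat[OF p] by (metis dvd_triv_left)
  have "b \<noteq> 0"
  proof
    assume "b = 0"
    then have "card M = card (carrier G)" using lag b G by (simp add: order_def)
    then have "M = carrier G" using card_subset_eq[OF fin subgroup.subset[OF sM]] by simp
    then show False using M by (simp add: maximal_subgroup_def)
  qed
  then have pE: "p dvd card (rcosets M)" using b by simp
  let ?f = "\<lambda>m. \<lambda>K\<in>rcosets M. K #> inv m"
  have ME: "M \<in> rcosets M" using subgroup.subgroup_in_rcosets[OF sM is_group] .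
  have "\<exists>K\<in>rcosets M. K \<noteq> M \<and> (\<forall>m\<in>carrier (G\<lparr>carrier := M\<rparr>). ?f m K = K)"
  proof (rule group_action.exists_other_fixed_point[OF rcosets_right_action[OF sM] p])
    show "order (G\<lparr>carrier := M\<rparr>) = p ^ a" using a by (simp add: order_def)
    show "finite (rcosets M)" using fin by (simp add: RCOSETS_def)
    show "?f m M = M" if "m \<in> carrier (G\<lparr>carrier := M\<rparr>)" for m
      using that ME coset_join2[OF _ sM, of "inv m"] Mc[of m] subgroup.m_inv_closed[OF sM, of m] by simp
  qed (use pE ME in auto)
  then obtain K where K: "K \<in> rcosets M" "K \<noteq> M" "\<And>m. m \<in> M \<Longrightarrow> K #> inv m = K" by auto
  then obtain x where x: "x \<in> carrier G" "K = M #> x" by (auto simp: RCOSETS_def)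
  have xM: "x \<notin> M" using K(2) x coset_join2[OF x(1) sM] by blast
  have conj: "x \<otimes> m \<otimes> inv x \<in> M" if m: "m \<in> M" for m
  proof -
    have "K #> m = K" using K(3)[OF subgroup.m_inv_closed[OF sM m]] Mc[OF m] by simp
    moreover have "x \<in> K" using rcos_self[OF x(1) sM] x(2) by simp
    ultimately have "x \<otimes> m \<in> K" unfolding r_coset_def by blast
    then obtain m' where "m' \<in> M" "x \<otimes> m = m' \<otimes> x" unfolding x(2) r_coset_def by blast
    then show ?thesis using x(1) Mc by (simp add: m_assoc)
  qed
  let ?c = "\<lambda>m. x \<otimes> m \<otimes> inv x"
  have "inj_on ?c M" using x(1) Mc by (intro inj_onI) simp
  moreover have "?c ` M \<subseteq> M" using conj by blast
  ultimately have surj: "?c ` M = M" using finM by (simp add: endo_inj_surj)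
  have conj': "inv x \<otimes> m \<otimes> x \<in> M" if m: "m \<in> M" for m
  proof -
    obtain k where k: "k \<in> M" "m = ?c k" using m surj by blast
    have "inv x \<otimes> (x \<otimes> (k \<otimes> (inv x \<otimes> x))) = k" using x(1) Mc[OF k(1)] by (simp add: m_assoc[symmetric])
    then have "inv x \<otimes> m \<otimes> x = k" using k x(1) Mc[OF k(1)] by (simp add: m_assoc)
    then show ?thesis using k(1) by simp
  qed
  \<comment> \<open>Asking for both conjugations makes closure under inverses immediate. For
    \<open>x\<close> the second one comes from finiteness of \<open>M\<close>, through
    \<open>surj\<close>.\<close>
  let ?N = "{y \<in> carrier G. \<forall>m\<in>M. y \<otimes> m \<otimes> inv y \<in> M \<and> inv y \<otimes> m \<otimes> y \<in> M}"
  have "subgroup ?N G"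
  proof (rule subgroupI)
    show "?N \<noteq> {}" using Mc by (auto intro!: exI[of _ \<one>])
    show "inv y \<in> ?N" if "y \<in> ?N" for y using that by auto
    fix y z assume yz: "y \<in> ?N" "z \<in> ?N"
    have yzc: "y \<in> carrier G" "z \<in> carrier G" using yz by auto
    have "(y \<otimes> z) \<otimes> m \<otimes> inv (y \<otimes> z) \<in> M \<and> inv (y \<otimes> z) \<otimes> m \<otimes> (y \<otimes> z) \<in> M" if m: "m \<in> M" for m
    proof -
      have "y \<otimes> (z \<otimes> m \<otimes> inv z) \<otimes> inv y \<in> M" "inv z \<otimes> (inv y \<otimes> m \<otimes> y) \<otimes> z \<in> M"
        using yz m by blast+
      then show ?thesis using yzc Mc[OF m] by (simp add: inv_mult_group m_assoc)
    qed
    then show "y \<otimes> z \<in> ?N" using yzc by simp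
  qed blast
  moreover have "M \<subseteq> ?N"
    using Mc subgroup.m_closed[OF sM] subgroup.m_inv_closed[OF sM] by (intro subsetI) simp
  moreover have "x \<in> ?N" using x(1) conj conj' by blast
  ultimately have "?N = carrier G" using M xM unfolding maximal_subgroup_def by blast
  then have "\<forall>y\<in>carrier G. \<forall>m\<in>M. y \<otimes> m \<otimes> inv y \<in> M" by blast
  then show ?thesis using sM normal_inv_iff by blast
qed

text \<open>Modulo \<open>M\<close> the group is generated by any element outside \<open>M\<close>.
  With a generator whose \<open>p\<close>-th power lies in \<open>M\<close>, all cosets are powers
  of one coset, so they commute and have exponent \<open>p\<close>.\<close>

lemma (in group) maximal_subgroup_quotient:
  assumes p: "Factorial_Ring.prime p" and G: "order G = p ^ n" and M: "maximal_subgroup M G"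
    and x: "x \<in> carrier G" and y: "y \<in> carrier G"
  shows "(x \<otimes> y) \<otimes> inv (y \<otimes> x) \<in> M" "x [^] p \<in> M"
proof -
  have sM: "subgroup M G" using M by (simp add: maximal_subgroup_def)
  interpret N: normal M G using maximal_subgroup_normal[OF p G M] .
  have Msub: "M \<subseteq> carrier G" using subgroup.subset[OF sM] .
  obtain w where w: "w \<in> carrier G" "w \<notin> M"
    using M Msub unfolding maximal_subgroup_def by blast
  have "w [^] (p ^ n) = \<one>" using pow_order_eq_1[OF w(1)] G by simp
  then have ex: "w [^] (p ^ n) \<in> M" using subgroup.one_closed[OF sM] by simp
  \<comment> \<open>The last of the iterated \<open>p\<close>-th powers of \<open>w\<close> that is
    still outside \<open>M\<close> is the generator \<open>?z\<close>.\<close>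
  define j where "j = (LEAST j. w [^] (p ^ j) \<in> M)"
  have j: "w [^] (p ^ j) \<in> M" unfolding j_def using ex by (rule LeastI)
  have "j \<noteq> 0" using j w by (intro notI) simp
  then obtain i where i: "j = Suc i" by (cases j) auto
  let ?z = "w [^] (p ^ i)"
  have z: "?z \<in> carrier G" "?z \<notin> M" "?z [^] p \<in> M"
    using w(1) j not_less_Least[of i "\<lambda>j. w [^] (p ^ j) \<in> M"] i unfolding j_def[symmetric]
    by (simp_all add: nat_pow_pow mult.commute)
  let ?H = "{g \<in> carrier G. \<exists>t::int. M #> g = M #> ?z [^] t}"
  have "subgroup ?H G"
  proof (rule subgroupI)
    have "M #> ?z = M #> ?z [^] (1::int)" using z(1) by (simp add: int_pow_1)
    then show "?H \<noteq> {}" using z(1) by blast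
  next
    fix g assume "g \<in> ?H"
    then obtain t :: int where g: "g \<in> carrier G" "M #> g = M #> ?z [^] t" by blast
    have "M #> inv g = set_inv (M #> ?z [^] t)" using N.rcos_inv[OF g(1)] g(2) by simp
    also have "\<dots> = M #> ?z [^] (- t)" using N.rcos_inv[of "?z [^] t"] z(1) by (simp add: int_pow_neg)
    finally show "inv g \<in> ?H" using g(1) by blast
  next
    fix g h assume "g \<in> ?H" "h \<in> ?H"
    then obtain s t :: int where g: "g \<in> carrier G" "M #> g = M #> ?z [^] s"
      and h: "h \<in> carrier G" "M #> h = M #> ?z [^] t" by blast
    have "M #> (g \<otimes> h) = (M #> ?z [^] s) <#> (M #> ?z [^] t)"
      using N.rcos_sum[OF g(1) h(1)] g(2) h(2) by simp
    also have "\<dots> = M #> ?z [^] (s + t)" using N.rcos_sum z(1) by (simp add: int_pow_mult)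
    finally show "g \<otimes> h \<in> ?H" using g(1) h(1) by blast
  qed blast
  moreover have "M \<subseteq> ?H"
  proof
    fix m assume m: "m \<in> M"
    then have mc: "m \<in> carrier G" using Msub by blast
    have "M #> m = M #> ?z [^] (0::int)" using coset_join2[OF mc sM m] Msub by simp
    then show "m \<in> ?H" using mc by blast
  qed
  moreover have "?z \<in> ?H"
  proof -
    have "M #> ?z = M #> ?z [^] (1::int)" using z(1) by (simp add: int_pow_1)
    then show ?thesis using z(1) by blast
  qed
  ultimately have H: "?H = carrier G" using M z(2) unfolding maximal_subgroup_def by blast
  have cosets: "\<exists>t::int. M #> g = M #> ?z [^] t" if "g \<in> carrier G" for g using that H by blast
  obtain s t :: int where st: "M #> x = M #> ?z [^] s" "M #> y = M #> ?z [^] t"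
    using cosets[OF x] cosets[OF y] by blast
  have "M #> (x \<otimes> y) = M #> ?z [^] (s + t)"
    using N.rcos_sum[OF x y] N.rcos_sum[of "?z [^] s" "?z [^] t"] st z(1) by (simp add: int_pow_mult)
  also have "?z [^] (s + t) = ?z [^] t \<otimes> ?z [^] s"
    using z(1) by (simp add: int_pow_mult[symmetric] add.commute)
  also have "M #> \<dots> = M #> (y \<otimes> x)"
    using N.rcos_sum[OF y x] N.rcos_sum[of "?z [^] t" "?z [^] s"] st z(1) by simp
  finally have "x \<otimes> y \<in> M #> (y \<otimes> x)" using rcos_self[of "x \<otimes> y" M] x y sM by simp
  then obtain m where "m \<in> M" "x \<otimes> y = m \<otimes> (y \<otimes> x)" unfolding r_coset_def by blast
  moreover have "m \<in> carrier G" if "m \<in> M" for m using that Msub by blast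
  ultimately show "(x \<otimes> y) \<otimes> inv (y \<otimes> x) \<in> M" using x y by (simp add: m_assoc)
  have "M #> (x [^] p) = (M #> x) [^]\<^bsub>G Mod M\<^esub> p" using N.FactGroup_pow[OF x, of p] by simp
  also have "\<dots> = M #> ((?z [^] s) [^] p)"
    using N.FactGroup_pow[of "?z [^] s" p] z(1) st(1) by simp
  also have "(?z [^] s) [^] p = (?z [^] p) [^] s"
    using z(1) by (metis int_pow_int int_pow_pow mult.commute)
  also have "M #> \<dots> = M"
    using subgroup_int_pow_closed[OF sM z(3)] z(1) coset_join2[OF _ sM] by simp
  finally have "x [^] p \<in> M" using rcos_self[of "x [^] p" M] x sM by simp
  then show "x [^] p \<in> M" .
qed

section \<open>Coordinates\<close>

lemma carrier_cyclic_power: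
  "0 < p \<Longrightarrow> carrier (cyclic_power p d) = (\<Pi>\<^sub>E i\<in>{..<d}. {0..<int p})"
  by (simp add: cyclic_power_def carrier_integer_mod_group)

lemma group_cyclic_power: "group (cyclic_power p d)"
  unfolding cyclic_power_def by simp

lemma cyclic_power_pow:
  assumes "v \<in> carrier (cyclic_power p d)"
  shows "v [^]\<^bsub>cyclic_power p d\<^esub> (n::nat) = (\<lambda>i\<in>{..<d}. (int n * v i) mod int p)"
proof (induction n)
  case 0
  then show ?case by (simp add: cyclic_power_def)
next
  case (Suc n)
  have "v [^]\<^bsub>cyclic_power p d\<^esub> Suc n = v [^]\<^bsub>cyclic_power p d\<^esub> n \<otimes>\<^bsub>cyclic_power p d\<^esub> v"
    by simp
  then show ?case
    unfolding Suc by (simp add: cyclic_power_def fun_eq_iff restrict_def mod_simps distrib_right add.commute)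
qed

lemma p_group_if_iso_cyclic_power:
  fixes G (structure)
  assumes G: "group G" and p: "Factorial_Ring.prime p" and iso: "G \<cong> cyclic_power p d"
  shows "p_group p G"
proof -
  interpret group G by (rule G)
  interpret P: group "cyclic_power p d" by (rule group_cyclic_power)
  obtain h where h: "h \<in> iso G (cyclic_power p d)" using iso by (auto simp: is_iso_def)
  then interpret h: group_hom G "cyclic_power p d" h
    by unfold_locales (simp add: iso_def)
  have "\<exists>k::nat. ord x = p ^ k" if x: "x \<in> carrier G" for x
  proof -
    have hx: "h x \<in> carrier (cyclic_power p d)" using x by simp
    have "h (x [^] p) = h x [^]\<^bsub>cyclic_power p d\<^esub> p" using x by (simp add: h.hom_nat_pow)
    also have "\<dots> = \<one>\<^bsub>cyclic_power p d\<^esub>"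
      unfolding cyclic_power_pow[OF hx] by (simp add: cyclic_power_def)
    also have "\<dots> = h \<one>" by simp
    finally have eq: "h (x [^] p) = h \<one>" .
    have inj: "inj_on h (carrier G)" using h by (simp add: iso_def bij_betw_def)
    have "x [^] p = \<one>" by (rule inj_onD[OF inj eq]) (use x in simp_all)
    then have "ord x dvd p" using x pow_eq_id by simp
    then have "ord x = 1 \<or> ord x = p" using p by (simp add: prime_nat_iff)
    then show ?thesis by (metis power_0 power_one_right)
  qed
  then show ?thesis unfolding p_group_def using G by blast
qed

section \<open>Bases of elementary abelian groups\<close>

context elementary_abelian
begin

text \<open>A linear combination of \<open>b 0\<close>, ..., \<open>b (n - 1)\<close>. The
  conversion \<open>nat\<close> loses nothing on vectors of \<open>cyclic_power p n\<close>, whose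
  entries are nonnegative.\<close>

primrec word :: "(nat \<Rightarrow> 'a) \<Rightarrow> nat \<Rightarrow> (nat \<Rightarrow> int) \<Rightarrow> 'a" where
  "word b 0 v = \<one>"
| "word b (Suc n) v = word b n v \<otimes> b n [^] nat (v n)"

lemma word_closed: "(\<And>i. i < n \<Longrightarrow> b i \<in> carrier G) \<Longrightarrow> word b n v \<in> carrier G"
  by (induction n) auto

lemma word_cong:
  "(\<And>i. i < n \<Longrightarrow> b i = b' i) \<Longrightarrow> (\<And>i. i < n \<Longrightarrow> v i = v' i) \<Longrightarrow> word b n v = word b' n v'"
  by (induction n) auto

lemma word_mult:
  assumes "\<And>i. i < n \<Longrightarrow> b i \<in> carrier G" "\<And>i. i < n \<Longrightarrow> 0 \<le> v i" "\<And>i. i < n \<Longrightarrow> 0 \<le> w i"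
    "\<And>i. i < n \<Longrightarrow> u i = (v i + w i) mod int p"
  shows "word b n u = word b n v \<otimes> word b n w"
  using assms
proof (induction n)
  case (Suc n)
  have bn: "b n \<in> carrier G" and wc: "word b n v \<in> carrier G" "word b n w \<in> carrier G"
    using Suc.prems by (auto intro: word_closed)
  have "nat (u n) = (nat (v n) + nat (w n)) mod p"
    using Suc.prems by (simp add: nat_mod_distrib nat_add_distrib)
  then have "b n [^] nat (u n) = b n [^] nat (v n) \<otimes> b n [^] nat (w n)"
    using bn by (simp add: pow_mod nat_pow_mult)
  moreover have "word b n u = word b n v \<otimes> word b n w" using Suc by simp
  ultimately show ?case using bn wc by (simp add: m_ac)
qed simp

lemma word_hom:
  assumes "\<And>i. i < n \<Longrightarrow> b i \<in> carrier G"
  shows "word b n \<in> hom (cyclic_power p n) G"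
proof (rule homI)
  have p0: "0 < p" using p_ge_2 by simp
  show "word b n v \<in> carrier G" for v using assms by (rule word_closed)
  fix v w assume "v \<in> carrier (cyclic_power p n)" "w \<in> carrier (cyclic_power p n)"
  then have "0 \<le> v i" "0 \<le> w i" if "i < n" for i
    using that by (auto simp: carrier_cyclic_power[OF p0] PiE_iff)
  then show "word b n (v \<otimes>\<^bsub>cyclic_power p n\<^esub> w) = word b n v \<otimes> word b n w"
    using assms by (intro word_mult) (auto simp: cyclic_power_def)
qed

text \<open>Basis extension: the span of \<open>n < d\<close> independent elements has order
  \<open>p ^ n\<close>, so some \<open>c\<close> lies outside it and can be added.\<close>

lemma exists_independent:
  assumes "card (carrier G) = p ^ d" "n \<le> d"
  shows "\<exists>b. (\<forall>i<n. b i \<in> carrier G) \<and> inj_on (word b n) (carrier (cyclic_power p n))"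
  using assms(2)
proof (induction n)
  case 0
  then show ?case using p_ge_2 by (simp add: carrier_cyclic_power)
next
  case (Suc n)
  then obtain b where b: "\<And>i. i < n \<Longrightarrow> b i \<in> carrier G"
    and inj: "inj_on (word b n) (carrier (cyclic_power p n))" by auto
  have p0: "0 < p" using p_ge_2 by simp
  let ?S = "word b n ` carrier (cyclic_power p n)"
  interpret h: group_hom "cyclic_power p n" G "word b n"
    using word_hom[OF b] group_cyclic_power by (simp add: group_hom_def group_hom_axioms_def is_group)
  have S: "subgroup ?S G" by (rule h.img_is_subgroup)
  have "card ?S = p ^ n"
    using inj p0 by (simp add: card_image carrier_cyclic_power card_PiE)
  also have "\<dots> < card (carrier G)"
    using assms(1) Suc.prems p_ge_2 by (simp add: power_strict_increasing)
  finally have "?S \<noteq> carrier G" by (metis less_irrefl)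
  then obtain c where c: "c \<in> carrier G" "c \<notin> ?S" using subgroup.subset[OF S] by blast
  let ?b = "b(n := c)"
  have word_Suc: "word ?b (Suc n) v = word b n (restrict v {..<n}) \<otimes> c [^] nat (v n)" for v
    using word_cong[of n ?b b v "restrict v {..<n}"] by simp
  have "inj_on (word ?b (Suc n)) (carrier (cyclic_power p (Suc n)))"
  proof (rule inj_onI)
    fix v w assume v: "v \<in> carrier (cyclic_power p (Suc n))" and w: "w \<in> carrier (cyclic_power p (Suc n))"
      and "word ?b (Suc n) v = word ?b (Suc n) w"
    let ?P = "word b n (restrict v {..<n})" and ?Q = "word b n (restrict w {..<n})"
    have eq: "?P \<otimes> c [^] nat (v n) = ?Q \<otimes> c [^] nat (w n)"
      using \<open>word ?b (Suc n) v = word ?b (Suc n) w\<close> by (simp only: word_Suc)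
    have vw: "restrict v {..<n} \<in> carrier (cyclic_power p n)" "restrict w {..<n} \<in> carrier (cyclic_power p n)"
      and n: "0 \<le> v n" "v n < int p" "0 \<le> w n" "w n < int p"
      using v w by (auto simp: carrier_cyclic_power[OF p0] PiE_iff)
    have PQ: "?P \<in> ?S" "?Q \<in> ?S" using vw by blast+
    then have PQc: "?P \<in> carrier G" "?Q \<in> carrier G" using subgroup.mem_carrier[OF S] by blast+
    \<comment> \<open>Shifting this inverse by \<open>c\<close> to either last coefficient lands in
      the span \<open>?S\<close>, so the two coefficients agree by
      \<open>shift_unique\<close>.\<close>
    let ?y = "inv (?P \<otimes> c [^] nat (v n))"
    have "?y \<otimes> c [^] nat (v n) = inv ?P" "inv (?Q \<otimes> c [^] nat (w n)) \<otimes> c [^] nat (w n) = inv ?Q"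
      using PQc c(1) by (simp_all add: inv_mult m_assoc)
    then have "?y \<otimes> c [^] nat (v n) \<in> ?S" "?y \<otimes> c [^] nat (w n) \<in> ?S"
      unfolding eq using subgroup.m_inv_closed[OF S] PQ by (simp_all only:)
    then have "nat (v n) = nat (w n)"
      using n PQc c(1) by (intro shift_unique[OF S c, of ?y]) auto
    then have vn: "v n = w n" using n by simp
    then have "?P = ?Q" using eq PQc c(1) by simp
    then have "restrict v {..<n} = restrict w {..<n}" using inj vw by (simp add: inj_on_eq_iff)
    then have "v i = w i" if "i < n" for i using that by (metis lessThan_iff restrict_apply')
    then have "v i = w i" if "i \<in> {..<Suc n}" for i using that vn by (auto simp: less_Suc_eq)
    then show "v = w" using v w by (intro PiE_ext) (auto simp: carrier_cyclic_power[OF p0])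
  qed
  moreover have "\<forall>i<Suc n. ?b i \<in> carrier G" using b c(1) by (simp add: less_Suc_eq)
  ultimately show ?case by blast
qed

lemma iso_cyclic_power:
  assumes "card (carrier G) = p ^ d"
  shows "G \<cong> cyclic_power p d"
proof -
  have p0: "0 < p" using p_ge_2 by simp
  obtain b where b: "\<And>i. i < d \<Longrightarrow> b i \<in> carrier G"
    and inj: "inj_on (word b d) (carrier (cyclic_power p d))"
    using exists_independent[OF assms le_refl] by blast
  have hom: "word b d \<in> hom (cyclic_power p d) G" using b by (rule word_hom)
  have "card (word b d ` carrier (cyclic_power p d)) = card (carrier G)"
    using inj p0 assms by (simp add: card_image carrier_cyclic_power card_PiE)
  moreover have "word b d ` carrier (cyclic_power p d) \<subseteq> carrier G"
    using hom by (auto simp: hom_def)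
  ultimately have "word b d ` carrier (cyclic_power p d) = carrier G"
    using finite_carrier by (metis card_subset_eq)
  then have "word b d \<in> iso (cyclic_power p d) G"
    using inj hom by (simp add: iso_def bij_betw_def)
  then have "cyclic_power p d \<cong> G" by (auto simp: is_iso_def)
  then show ?thesis using group.iso_sym[OF group_cyclic_power] by blast
qed

end

section \<open>Reduction to the elementary abelian case, and the classification\<close>

lemma nine_cover_of_p_group:
  assumes p: "Factorial_Ring.prime p" and G: "p_group p G" and C: "Cn_cover 9 G C"
  shows "nine_cover G p C \<and> (\<exists>n. order G = p ^ n)"
proof -
  interpret group G using G by (simp add: p_group_def)
  have finC: "finite C" and cardC: "card C = 9" and cover: "\<Union>C = carrier G"
    and max: "\<And>M. M \<in> C \<Longrightarrow> maximal_subgroup M G"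
    and core: "normal_core G (\<Inter>C) = {\<one>\<^bsub>G\<^esub>}"
    using C by (auto simp: Cn_cover_def maximal_cover_def core_free_cover_def group_cover_def)
  have sub: "subgroup M G" if "M \<in> C" for M using max[OF that] by (simp add: maximal_subgroup_def)
  have priv: "\<exists>c\<in>carrier G. \<forall>N\<in>C - {M}. c \<notin> N" if M: "M \<in> C" for M
  proof -
    have "\<not> group_cover G (C - {M})"
      using C M unfolding Cn_cover_def irredundant_cover_def by blast
    moreover have "\<forall>H\<in>C - {M}. subgroup H G \<and> H \<noteq> carrier G"
      using max by (simp add: maximal_subgroup_def)
    ultimately have "\<Union>(C - {M}) \<noteq> carrier G" unfolding group_cover_def by blast
    moreover have "\<Union>(C - {M}) \<subseteq> carrier G" using cover by blast
    ultimately show ?thesis by blast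
  qed
  have ne: "C \<noteq> {}" using cardC by (intro notI) simp
  have sD: "subgroup (\<Inter>C) G" using sub ne by (rule subgroups_Inter)
  have covered: "\<exists>M\<in>C. g \<in> M" if "g \<in> carrier G" for g using that cover by blast
  obtain T where T: "finite T" "T \<subseteq> carrier G" "\<And>g. g \<in> carrier G \<Longrightarrow> \<exists>t\<in>T. g \<otimes>\<^bsub>G\<^esub> inv\<^bsub>G\<^esub> t \<in> \<Inter>C"
    using finite_coset_cover[OF finC sub covered priv] by blast
  have fin: "finite (carrier G)" using finite_if_core_free[OF sD core T] .
  obtain n where n: "order G = p ^ n"
    using order_p_group[OF fin p] G by (auto simp: p_group_def)
  have normal: "M \<lhd> G" if "M \<in> C" for M using maximal_subgroup_normal[OF p n max[OF that]] .
  \<comment> \<open>All members are normal, so their intersection is its own core and hence trivial;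
    commutators and \<open>p\<close>-th powers are then killed.\<close>
  have D: "u = \<one>\<^bsub>G\<^esub>" if u: "\<And>M. M \<in> C \<Longrightarrow> u \<in> M" "u \<in> carrier G" for u
  proof -
    have "u \<in> normal_core G (\<Inter>C)"
    proof (rule mem_normal_core[OF u(2)])
      fix g assume g: "g \<in> carrier G"
      show "g \<otimes>\<^bsub>G\<^esub> u \<otimes>\<^bsub>G\<^esub> inv\<^bsub>G\<^esub> g \<in> \<Inter>C"
        using normal.inv_op_closed2[OF normal g u(1)] by blast
    qed
    then show ?thesis using core by simp
  qed
  have comm: "x \<otimes>\<^bsub>G\<^esub> y = y \<otimes>\<^bsub>G\<^esub> x" if xy: "x \<in> carrier G" "y \<in> carrier G" for x y
  proof -
    have "(x \<otimes>\<^bsub>G\<^esub> y) \<otimes>\<^bsub>G\<^esub> inv\<^bsub>G\<^esub> (y \<otimes>\<^bsub>G\<^esub> x) = \<one>\<^bsub>G\<^esub>"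
      using maximal_subgroup_quotient(1)[OF p n max xy] xy by (intro D) simp_all
    then show ?thesis using xy by (metis inv_closed inv_equality inv_inv m_closed)
  qed
  have expo: "x [^]\<^bsub>G\<^esub> p = \<one>\<^bsub>G\<^esub>" if x: "x \<in> carrier G" for x
    using maximal_subgroup_quotient(2)[OF p n max x x] x by (intro D) simp_all
  have cg: "comm_group G" using comm by (rule group_comm_groupI)
  have ea: "elementary_abelian G p"
    using cg fin p expo by (simp add: elementary_abelian_def elementary_abelian_axioms_def)
  have hc: "hyperplane_cover G p C"
    using ea finC max covered priv by (simp add: hyperplane_cover_def hyperplane_cover_axioms_def)
  have "elementary_abelian.common G C = {\<one>\<^bsub>G\<^esub>}"
    using D subgroup.one_closed[OF sub] unfolding elementary_abelian.common_def[OF ea] by blast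
  then have "nine_cover G p C"
    using hc cardC by (simp add: nine_cover_def nine_cover_axioms_def)
  then show ?thesis using n by blast
qed

theorem theorem1p6:
  fixes G :: "('a, 'b) monoid_scheme"
  assumes "Cn_group 9 G"
  shows "(\<exists>p::nat. Factorial_Ring.prime p \<and> p_group p G) \<longleftrightarrow>
    G \<cong> cyclic_power 2 8 \<or> G \<cong> cyclic_power 3 5 \<or> G \<cong> cyclic_power 5 3"
proof
  obtain C where C: "Cn_cover 9 G C" using assms by (auto simp: Cn_group_def)
  assume "\<exists>p::nat. Factorial_Ring.prime p \<and> p_group p G"
  then obtain p where p: "Factorial_Ring.prime p" "p_group p G" by blast
  from nine_cover_of_p_group[OF p C] obtain n where nine: "nine_cover G p C" and n: "order G = p ^ n"
    by blast
  interpret nine_cover G p C by (rule nine)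
  have N: "card (carrier G) = p ^ n" using n by (simp add: order_def)
  have "p = 2 \<or> p = 3 \<or> p = 5" using p_cases p_neq_7 by auto
  then show "G \<cong> cyclic_power 2 8 \<or> G \<cong> cyclic_power 3 5 \<or> G \<cong> cyclic_power 5 3"
  proof (elim disjE)
    assume p2: "p = 2"
    have "C \<noteq> {}" using card_cover by (intro notI) simp
    then have "card (carrier G) = p ^ 8"
      using order_binary[OF p2 _ common_trivial] card_cover p2 by simp
    then show ?thesis using iso_cyclic_power[of 8] p2 by simp
  next
    assume p3: "p = 3"
    then have "n = 5" using order_3_ge[of n] order_3_le[of n] N by simp
    then show ?thesis using iso_cyclic_power[OF N] p3 by simp
  next
    assume p5: "p = 5"
    have "(5::nat) ^ n < 5 ^ 4" using order_5_le[OF p5] N p5 by simp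
    then have "n < 4" by (rule power_less_imp_less_exp[rotated]) simp
    obtain K L where KL: "K \<in> C" "L \<in> C" "K \<noteq> L" by (rule obtain_pair)
    have "(5::nat) ^ n = 25 * card (K \<inter> L)" using card_pair[OF KL] N p5 by simp
    then have "(5::nat) ^ n \<noteq> 1" "(5::nat) ^ n \<noteq> 5" by presburger+
    then have "n \<noteq> 0" "n \<noteq> 1" by auto
    moreover have "n \<noteq> 2" using order_neq_p_squared[OF p5] N p5 by (intro notI) simp
    ultimately have "n = 3" using \<open>n < 4\<close> by linarith
    then show ?thesis using iso_cyclic_power[OF N] p5 by simp
  qed
next
  have G: "group G" using assms by (simp add: Cn_group_def)
  have primes: "Factorial_Ring.prime (2::nat)" "Factorial_Ring.prime (3::nat)" "Factorial_Ring.prime (5::nat)"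
    by simp_all
  assume "G \<cong> cyclic_power 2 8 \<or> G \<cong> cyclic_power 3 5 \<or> G \<cong> cyclic_power 5 3"
  then show "\<exists>p::nat. Factorial_Ring.prime p \<and> p_group p G"
    using p_group_if_iso_cyclic_power[OF G] primes by blast
qed

end
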